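(* Let $\mathbb{F}_q$ be a finite field with $q$ elements and characteristic $p$, and let $n,k,r$ be positive integers. (1) If $r$ is not of the form $p^i$ with $i\ge 0$ an integer, then $$\left|\overline{\mathcal{P}_{(n,2,k),r}}\right|=\left|\overline{\mathcal{P}_{(n,2,1),r}}\right|\left|\mathbb{P}^{k-1}(\mathbb{F}_q)\right|+\binom{\left|\overline{\mathcal{P}_{(n,1,1),r}}\right|}{2}\frac{N_q(2,k,2)}{q-1}.$$ (2) If $r=p^i$ for some integer $i\ge 0$, then $$\left|\overline{\mathcal{P}_{(n,2,k),r}}\right|=\left|\overline{\mathcal{P}_{(n,2,1),r}}\right|\left|\mathbb{P}^{k-1}(\mathbb{F}_q)\right|+\frac{2}{(q+1)q}\binom{\left|\overline{\mathcal{P}_{(n,1,1),r}}\right|}{2}\frac{N_q(2,k,2)}{q-1}.$$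
   Context: For a field $\mathbb{F}$, $S^r(\mathbb{F}^n)$ denotes the space of homogeneous polynomials of degree $r$ in $x_1,\dots,x_n$ over $\mathbb{F}$ (including $0$). For positive integers $n,m,k,r$, the neuromanifold $\mathcal{P}_{(n,m,k),r}\subseteq (S^r(\mathbb{F}_q^n))^k$ is the set of all $k$-tuples of polynomials $(f_1,\dots,f_k)$ of the form $f_i=\sum_{s=1}^m b_{is}(a_{s1}x_1+\dots+a_{sn}x_n)^r$, $i=1,\dots,k$, with $(a_{sj})\in\mathbb{F}_q^{m\times n}$ and $(b_{is})\in\mathbb{F}_q^{k\times m}$ arbitrary. Viewing $(S^r(\mathbb{F}_q^n))^k$ as $\mathbb{F}_q^N$ with $N=k\binom{n+r-1}{r}$, $\overline{\mathcal{P}_{(n,m,k),r}}$ denotes the image of $\mathcal{P}_{(n,m,k),r}\setminus\{0\}$ in $\mathbb{P}^{N-1}(\mathbb{F}_q)$, i.e. its set of classes modulo nonzero scalars. $N_q(2,k,2)$ is the number of $k\times 2$ matrices of rank $2$ over $\mathbb{F}_q$, i.e. $(q^k-1)(q^k-q)$. *)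

theory Defs
  imports "HOL-Library.Poly_Mapping" "Jordan_Normal_Form.DL_Rank"
begin

text \<open>
  Multivariate polynomials are finitely supported functions from exponent vectors to coefficients,
  with the convolution product. Variables, rows and columns are numbered from 0, so the
  polynomials in \<open>n\<close> variables are those involving only the variables \<open>0, \<dots>, n - 1\<close>.
\<close>

type_synonym 'a mpoly = "(nat \<Rightarrow>\<^sub>0 nat) \<Rightarrow>\<^sub>0 'a"

definition mvar :: "nat \<Rightarrow> 'a::field mpoly" where
  "mvar j = Poly_Mapping.single (Poly_Mapping.single j 1) 1"

definition mscale :: "'a::field \<Rightarrow> 'a mpoly \<Rightarrow> 'a mpoly" where
  "mscale c f = Poly_Mapping.map ((*) c) f"

definition homogeneous_polys :: "nat \<Rightarrow> nat \<Rightarrow> 'a::field mpoly set" where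
  "homogeneous_polys n r =
    {f. \<forall>e \<in> Poly_Mapping.keys f.
          Poly_Mapping.keys e \<subseteq> {..<n} \<and> (\<Sum>j<n. Poly_Mapping.lookup e j) = r}"

definition linear_form :: "nat \<Rightarrow> (nat \<Rightarrow> 'a::field) \<Rightarrow> 'a mpoly" where
  "linear_form n a = (\<Sum>j<n. mscale (a j) (mvar j))"

definition network_map :: "nat \<Rightarrow> nat \<Rightarrow> nat \<Rightarrow> nat \<Rightarrow> 'a::field mat \<Rightarrow> 'a mat \<Rightarrow> 'a mpoly vec" where
  "network_map n m k r A B =
    vec k (\<lambda>i. \<Sum>s<m. mscale (B $$ (i, s)) (linear_form n (\<lambda>j. A $$ (s, j)) ^ r))"

definition neuromanifold :: "nat \<Rightarrow> nat \<Rightarrow> nat \<Rightarrow> nat \<Rightarrow> 'a::field mpoly vec set" where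
  "neuromanifold n m k r =
    {network_map n m k r A B | A B. A \<in> carrier_mat m n \<and> B \<in> carrier_mat k m}"

text \<open>
  The set of classes, modulo nonzero scalars, of the elements of \<open>X\<close> other than the zero vector \<open>z\<close>.
\<close>

definition projectivization :: "('a::field \<Rightarrow> 'v \<Rightarrow> 'v) \<Rightarrow> 'v \<Rightarrow> 'v set \<Rightarrow> 'v set set" where
  "projectivization scale z X = (\<lambda>v. {scale c v | c. c \<noteq> 0}) ` (X - {z})"

definition proj_neuromanifold :: "nat \<Rightarrow> nat \<Rightarrow> nat \<Rightarrow> nat \<Rightarrow> 'a::field mpoly vec set set" where
  "proj_neuromanifold n m k r =
    projectivization (\<lambda>c. map_vec (mscale c)) (0\<^sub>v k) (neuromanifold n m k r)"

text \<open>The argument is the dimension \<open>k\<close> of the vector space, so this is the projective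
  space of dimension \<open>k - 1\<close>.\<close>

definition proj_space :: "nat \<Rightarrow> 'a::field vec set set" where
  "proj_space k = projectivization (\<cdot>\<^sub>v) (0\<^sub>v k) (carrier_vec k)"

definition matrices_of_rank :: "nat \<Rightarrow> nat \<Rightarrow> nat \<Rightarrow> 'a::field mat set" where
  "matrices_of_rank k m s = {A \<in> carrier_mat k m. vec_space.rank k A = s}"

lemma mscale_eq_mult: "mscale c f = Poly_Mapping.single 0 c * f"
  by (simp add: mscale_def mult_map_scale_conv_mult)

lemma homogeneous_polys_0: "0 \<in> homogeneous_polys n r"
  by (simp add: homogeneous_polys_def)

lemma homogeneous_polys_add:
  "f \<in> homogeneous_polys n r \<Longrightarrow> g \<in> homogeneous_polys n r \<Longrightarrow> f + g \<in> homogeneous_polys n r"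
  using Poly_Mapping.keys_add[of f g] unfolding homogeneous_polys_def by blast

lemma homogeneous_polys_sum:
  "(\<And>i. i \<in> I \<Longrightarrow> f i \<in> homogeneous_polys n r) \<Longrightarrow> sum f I \<in> homogeneous_polys n r"
  by (induction I rule: infinite_finite_induct)
     (auto intro: homogeneous_polys_0 homogeneous_polys_add)

lemma homogeneous_polys_mult:
  assumes "f \<in> homogeneous_polys n r" "g \<in> homogeneous_polys n s"
  shows "f * g \<in> homogeneous_polys n (r + s)"
  unfolding homogeneous_polys_def
proof (intro CollectI ballI)
  fix e assume "e \<in> Poly_Mapping.keys (f * g)"
  then obtain a b where e: "e = a + b" "a \<in> Poly_Mapping.keys f" "b \<in> Poly_Mapping.keys g"
    using Poly_Mapping.keys_mult[of f g] by blast
  have "Poly_Mapping.keys e \<subseteq> Poly_Mapping.keys a \<union> Poly_Mapping.keys b"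
    using Poly_Mapping.keys_add[of a b] e by simp
  moreover have "Poly_Mapping.keys a \<subseteq> {..<n}" "(\<Sum>j<n. Poly_Mapping.lookup a j) = r"
    and "Poly_Mapping.keys b \<subseteq> {..<n}" "(\<Sum>j<n. Poly_Mapping.lookup b j) = s"
    using e assms unfolding homogeneous_polys_def by blast+
  ultimately show "Poly_Mapping.keys e \<subseteq> {..<n} \<and> (\<Sum>j<n. Poly_Mapping.lookup e j) = r + s"
    unfolding e by (simp only: lookup_add sum.distrib) blast
qed

lemma homogeneous_polys_const: "Poly_Mapping.single 0 c \<in> homogeneous_polys n 0"
  by (simp add: homogeneous_polys_def)

lemma homogeneous_polys_mscale: "f \<in> homogeneous_polys n r \<Longrightarrow> mscale c f \<in> homogeneous_polys n r"
  using homogeneous_polys_mult[OF homogeneous_polys_const, of f n r c] by (simp add: mscale_eq_mult)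

lemma homogeneous_polys_power:
  assumes "f \<in> homogeneous_polys n s"
  shows "f ^ r \<in> homogeneous_polys n (r * s)"
proof (induction r)
  case 0
  then show ?case using homogeneous_polys_const[of 1 n] by simp
next
  case (Suc r)
  then show ?case using homogeneous_polys_mult[OF assms Suc] by simp
qed

lemma homogeneous_polys_mvar: "j < n \<Longrightarrow> mvar j \<in> homogeneous_polys n 1"
  by (simp add: homogeneous_polys_def mvar_def lookup_single when_def)

lemma neuromanifold_subset:
  "neuromanifold n m k r \<subseteq> {f \<in> carrier_vec k. \<forall>i<k. f $ i \<in> homogeneous_polys n r}"
proof -
  have "linear_form n a \<in> homogeneous_polys n 1" for a :: "nat \<Rightarrow> 'a"
    unfolding linear_form_def
    by (intro homogeneous_polys_sum homogeneous_polys_mscale homogeneous_polys_mvar) simp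
  then have "linear_form n a ^ r \<in> homogeneous_polys n r" for a :: "nat \<Rightarrow> 'a"
    using homogeneous_polys_power[of "linear_form n a" n 1 r] by simp
  then show ?thesis
    by (auto simp: neuromanifold_def network_map_def
        intro!: homogeneous_polys_sum homogeneous_polys_mscale)
qed

end

theory Submission
  imports Defs "HOL-Computational_Algebra.Polynomial" "HOL-Computational_Algebra.Primes"
begin

text \<open>
  A nonzero tuple in the neuromanifold has entries spanning a space of dimension 1 or 2.
  The tuples of rank 1 are the products of a nonzero vector of scalars with a nonzero sum of two
  multiples of \<open>r\<close>-th powers of linear forms, uniquely up to a scalar; this gives the first summand.
  The tuples of rank 2 are distributed evenly over the planes spanned by two such powers, with as
  many tuples in each plane as there are matrices of rank 2.
  Counting ordered pairs of independent powers, the number of planes is determined by the number of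
  powers in each plane. If \<open>r\<close> is a power of the characteristic, the multiples of \<open>r\<close>-th powers form
  a subspace by Frobenius, so a plane contains \<open>q + 1\<close> points; otherwise a third power
  in the plane would make all inner binomial coefficients \<open>r choose i\<close> vanish, so there are only 2.
\<close>

section \<open>Counting vectors, points and matrices\<close>

lemma card_eq_mult_card_fibres:
  assumes "finite A" "finite B" "f ` A \<subseteq> B"
    and "\<And>y. y \<in> B \<Longrightarrow> card {x \<in> A. f x = y} = t"
  shows "card A = t * card B"
proof -
  have "card A = (\<Sum>y\<in>B. \<Sum>x\<in>{x \<in> A. f x = y}. 1)"
    using sum.group[OF assms(1-3), of "\<lambda>_. 1::nat"] by simp
  also have "\<dots> = (\<Sum>y\<in>B. t)"
    using assms(4) by (intro sum.cong) auto
  finally show ?thesis by simp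
qed

lemma finite_carrier_vec: "finite (carrier_vec k :: 'a::finite vec set)"
proof -
  have "v \<in> vec k ` PiE {..<k} (\<lambda>_. UNIV)" if "v \<in> carrier_vec k" for v :: "'a vec"
    using that by (intro image_eqI[of _ _ "restrict (($) v) {..<k}"]) auto
  then have "carrier_vec k \<subseteq> (vec k ` PiE {..<k} (\<lambda>_. UNIV) :: 'a vec set)" by blast
  then show ?thesis by (rule finite_subset) (intro finite_imageI finite_PiE; simp)
qed

lemma finite_carrier_mat: "finite (carrier_mat k m :: 'a::finite mat set)"
proof -
  have "A \<in> mat k m ` PiE ({..<k} \<times> {..<m}) (\<lambda>_. UNIV)" if "A \<in> carrier_mat k m" for A :: "'a mat"
    using that by (intro image_eqI[of _ _ "restrict (($$) A) ({..<k} \<times> {..<m})"]) auto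
  then have "carrier_mat k m \<subseteq> (mat k m ` PiE ({..<k} \<times> {..<m}) (\<lambda>_. UNIV) :: 'a mat set)"
    by blast
  then show ?thesis by (rule finite_subset) (intro finite_imageI finite_PiE; simp)
qed

lemma card_nonzero: "card {c::'a::{field,finite}. c \<noteq> 0} = card (UNIV :: 'a set) - 1"
proof -
  have "{c::'a. c \<noteq> 0} = UNIV - {0}" by auto
  then show ?thesis by (simp add: card_Diff_singleton)
qed

lemma card_field_ge_two: "card (UNIV :: 'a::{field,finite} set) \<ge> 2"
proof -
  have "card {0::'a, 1} \<le> card (UNIV :: 'a set)" by (intro card_mono) auto
  then show ?thesis by simp
qed

lemma inj_vec_1: "inj (\<lambda>g::'b. vec 1 (\<lambda>_. g))"
proof (rule injI)
  fix g h :: 'b assume "vec 1 (\<lambda>_. g) = vec 1 (\<lambda>_. h)"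
  then have "vec 1 (\<lambda>_. g) $ 0 = vec 1 (\<lambda>_. h) $ 0" by (rule arg_cong)
  then show "g = h" by simp
qed

text \<open>The nonzero scalars act freely, so every class is an orbit of q - 1 vectors, where q is
  the size of the field. The scaling is left abstract because vectors of scalars and vectors of
  polynomials are both counted this way.\<close>

lemma card_diff_zero_eq_projectivization:
  fixes scale :: "'a::{field,finite} \<Rightarrow> 'v \<Rightarrow> 'v"
  assumes fin: "finite X"
    and closed: "\<And>c v. v \<in> X - {z} \<Longrightarrow> c \<noteq> 0 \<Longrightarrow> scale c v \<in> X - {z}"
    and one: "\<And>v. v \<in> X - {z} \<Longrightarrow> scale 1 v = v"
    and mult: "\<And>c d v. v \<in> X - {z} \<Longrightarrow> scale c (scale d v) = scale (c * d) v"
    and free: "\<And>c d v. v \<in> X - {z} \<Longrightarrow> scale c v = scale d v \<Longrightarrow> c = d"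
  shows "card (X - {z}) = (card (UNIV :: 'a set) - 1) * card (projectivization scale z X)"
proof -
  define orb where "orb v = {scale c v | c. c \<noteq> 0}" for v
  have orb_eq: "orb (scale c v) = orb v" if v: "v \<in> X - {z}" and "c \<noteq> 0" for c v
  proof -
    have *: "scale d v = scale (d / c) (scale c v)" for d
      using mult[OF v] \<open>c \<noteq> 0\<close> by simp
    show ?thesis
    proof (intro equalityI subsetI)
      fix w assume "w \<in> orb (scale c v)"
      then obtain d where "d \<noteq> 0" "w = scale d (scale c v)" by (auto simp: orb_def)
      then show "w \<in> orb v" using mult[OF v] \<open>c \<noteq> 0\<close> by (auto simp: orb_def)
    next
      fix w assume "w \<in> orb v"
      then obtain d where "d \<noteq> 0" "w = scale d v" by (auto simp: orb_def)
      then show "w \<in> orb (scale c v)"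
        unfolding orb_def using *[of d] \<open>c \<noteq> 0\<close> by (intro CollectI exI[of _ "d / c"]) auto
    qed
  qed
  have fibre: "{w \<in> X - {z}. orb w = orb v} = (\<lambda>c. scale c v) ` {c. c \<noteq> 0}"
    if v: "v \<in> X - {z}" for v
  proof (intro equalityI subsetI)
    fix w assume w: "w \<in> {w \<in> X - {z}. orb w = orb v}"
    have "w \<in> orb w" unfolding orb_def using one[of w] w by (auto intro!: exI[of _ 1])
    then show "w \<in> (\<lambda>c. scale c v) ` {c. c \<noteq> 0}" using w by (auto simp: orb_def)
  next
    fix w assume "w \<in> (\<lambda>c. scale c v) ` {c. c \<noteq> 0}"
    then show "w \<in> {w \<in> X - {z}. orb w = orb v}" using closed[OF v] orb_eq[OF v] by auto
  qed
  have "card {w \<in> X - {z}. orb w = y} = card (UNIV :: 'a set) - 1" if y: "y \<in> orb ` (X - {z})" for y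
  proof -
    obtain v where v: "v \<in> X - {z}" "y = orb v" using y by blast
    have "inj_on (\<lambda>c. scale c v) {c. c \<noteq> 0}" using free[OF v(1)] by (auto intro: inj_onI)
    then show ?thesis by (simp only: v(2) fibre[OF v(1)] card_image card_nonzero)
  qed
  then have "card (X - {z}) = (card (UNIV :: 'a set) - 1) * card (orb ` (X - {z}))"
    using fin by (intro card_eq_mult_card_fibres) auto
  then show ?thesis by (simp add: projectivization_def orb_def[abs_def])
qed

section \<open>Full column rank and 2 x 2 minors\<close>

lemma full_column_rank_iff:
  fixes A :: "'a::field mat"
  assumes A: "A \<in> carrier_mat k m"
  shows "vec_space.rank k A = m \<longleftrightarrow> (\<forall>v \<in> carrier_vec m. A *\<^sub>v v = 0\<^sub>v k \<longrightarrow> v = 0\<^sub>v m)"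
proof -
  interpret vec_space "TYPE('a)" k .
  show ?thesis
  proof (cases "distinct (cols A)")
    case True
    then show ?thesis
      using lin_depI[OF A] lin_depE[OF A] full_rank_lin_indpt[OF A] lin_indpt_full_rank[OF A] by metis
  next
    \<comment> \<open>Independence concerns the set of columns, which hides a repetition. With a
      repeated column the rank is at most the number of distinct columns, and a difference of two
      unit vectors lies in the kernel.\<close>
    case False
    obtain S where "maximal S (\<lambda>T. T \<subseteq> set (cols A) \<and> lin_indpt T)"
      using maximal_exists[of "(\<lambda>T. T \<subseteq> set (cols A) \<and> lin_indpt T)" "card (set (cols A))" "{}"]
      by (meson List.finite_set card_mono empty_iff empty_subsetI finite_lin_indpt2 rev_finite_subset)
    then have "card S \<le> card (set (cols A))" "rank A = card S"
      using rank_card_indpt[OF A] by (auto simp: maximal_def intro: card_mono)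
    moreover have "card (set (cols A)) < m"
      using False A by (metis card_distinct card_length cols_length carrier_matD(2) le_neq_implies_less)
    ultimately have "rank A \<noteq> m" by simp
    moreover obtain i j where ij: "i < m" "j < m" "i \<noteq> j" "col A i = col A j"
      using False A by (auto simp: distinct_conv_nth)
    have "A *\<^sub>v unit_vec m i = col A i" if "i < m" for i
      using that A by (intro eq_vecI) auto
    then have "A *\<^sub>v (unit_vec m i - unit_vec m j) = 0\<^sub>v k"
      using A ij by (simp add: mult_minus_distrib_mat_vec)
    moreover have "unit_vec m i - unit_vec m j \<noteq> (0\<^sub>v m :: 'a vec)"
    proof
      assume "unit_vec m i - unit_vec m j = (0\<^sub>v m :: 'a vec)"
      then have "(unit_vec m i - unit_vec m j) $ i = (0::'a)" using ij by simp
      then show False using ij by simp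
    qed
    ultimately show ?thesis by (metis minus_carrier_vec unit_vec_carrier)
  qed
qed

text \<open>Both conditions mean a trivial kernel: a nonzero minor makes two of the equations
  solvable only by 0, and if all minors vanish, a kernel vector can be read off from a row.\<close>

lemma rank_eq_two_iff_minor:
  fixes A :: "'a::field mat"
  assumes A: "A \<in> carrier_mat k 2"
  shows "vec_space.rank k A = 2 \<longleftrightarrow>
    (\<exists>i<k. \<exists>j<k. A $$ (i, 0) * A $$ (j, 1) - A $$ (i, 1) * A $$ (j, 0) \<noteq> 0)"
    (is "_ \<longleftrightarrow> ?minor")
proof -
  have mv: "(A *\<^sub>v v) $ i = A $$ (i, 0) * v $ 0 + A $$ (i, 1) * v $ 1"
    if "v \<in> carrier_vec 2" "i < k" for v i
    using that A by (simp add: scalar_prod_def numeral_2_eq_2)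
  have "?minor \<longleftrightarrow> (\<forall>v \<in> carrier_vec 2. A *\<^sub>v v = 0\<^sub>v k \<longrightarrow> v = 0\<^sub>v 2)"
  proof (intro iffI ballI impI)
    fix v :: "'a vec" assume ?minor and v: "v \<in> carrier_vec 2" "A *\<^sub>v v = 0\<^sub>v k"
    then obtain i j where ij: "i < k" "j < k"
      and d: "A $$ (i, 0) * A $$ (j, 1) - A $$ (i, 1) * A $$ (j, 0) \<noteq> 0"  by blast
    have e: "A $$ (i, 0) * v $ 0 + A $$ (i, 1) * v $ 1 = 0"
      "A $$ (j, 0) * v $ 0 + A $$ (j, 1) * v $ 1 = 0"
      using mv[OF v(1) ij(1)] mv[OF v(1) ij(2)] v ij by simp_all
    \<comment> \<open>Cramer's rule: each unknown is isolated by eliminating the other one from the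
      two equations \<open>e\<close>.\<close>
    have "(a * d - b * c) * x = d * (a * x + b * y) - b * (c * x + d * y)"
      "(a * d - b * c) * y = a * (c * x + d * y) - c * (a * x + b * y)" for a b c d x y :: 'a
      by (simp_all add: algebra_simps)
    from this(1)[of "A $$ (i, 0)" "A $$ (j, 1)" "A $$ (i, 1)" "A $$ (j, 0)" "v $ 0" "v $ 1"]
      this(2)[of "A $$ (i, 0)" "A $$ (j, 1)" "A $$ (i, 1)" "A $$ (j, 0)" "v $ 1" "v $ 0"]
    have "(A $$ (i, 0) * A $$ (j, 1) - A $$ (i, 1) * A $$ (j, 0)) * v $ 0 = 0"
      "(A $$ (i, 0) * A $$ (j, 1) - A $$ (i, 1) * A $$ (j, 0)) * v $ 1 = 0"
      unfolding e by simp_all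
    then have "v $ 0 = 0" "v $ 1 = 0" using d by simp_all
    then show "v = 0\<^sub>v 2" using v by (auto simp: less_2_cases_iff)
  next
    assume inj: "\<forall>v \<in> carrier_vec 2. A *\<^sub>v v = 0\<^sub>v k \<longrightarrow> v = 0\<^sub>v 2"
    show ?minor
    proof (rule ccontr)
      assume no: "\<not> ?minor"
      have *: False if "x \<noteq> 0 \<or> y \<noteq> 0" and "\<And>i. i < k \<Longrightarrow> A $$ (i, 0) * x + A $$ (i, 1) * y = 0"
        for x y
      proof -
        define v where "v = vec 2 (\<lambda>i. if i = 0 then x else y)"
        have v: "v \<in> carrier_vec 2" "v $ 0 = x" "v $ 1 = y" by (simp_all add: v_def)
        have "A *\<^sub>v v = 0\<^sub>v k"
          using that(2) mv[OF v(1)] A unfolding v(2,3) by (intro eq_vecI) auto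
        then have "v = 0\<^sub>v 2" using inj v(1) by blast
        then have "x = 0" "y = 0" using v(2,3) by auto
        then show False using that(1) by simp
      qed
      show False
      proof (cases "\<exists>i<k. A $$ (i, 0) \<noteq> 0")
        case True
        then obtain i where "i < k" "A $$ (i, 0) \<noteq> 0" by blast
        \<comment> \<open>This vector annihilates row \<open>i\<close> by construction, and every
          other row because its minor with row \<open>i\<close> vanishes.\<close>
        then show False using no by (intro *[of "- A $$ (i, 1)" "A $$ (i, 0)"]) (auto simp: algebra_simps)
      next
        case False
        then show False by (intro *[of 1 0]) auto
      qed
    qed
  qed
  then show ?thesis using full_column_rank_iff[OF A] by simp
qed

section \<open>Tuples of combinations of two vectors from a cone\<close>

locale finite_scalars = vector_space scale
  for scale :: "'a::{field,finite} \<Rightarrow> 'b::ab_group_add \<Rightarrow> 'b" (infixr "*s" 75)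
begin

text \<open>Independence is required of the ordered pair, not of the set \<open>{u, v}\<close>, so
  that \<open>(u, u)\<close> is excluded.\<close>

definition indep_pairs :: "'b set \<Rightarrow> ('b \<times> 'b) set" where
  "indep_pairs X = {(u, v) \<in> X \<times> X. \<forall>a b. a *s u + b *s v = 0 \<longrightarrow> a = 0 \<and> b = 0}"

definition planes :: "'b set \<Rightarrow> 'b set set" where
  "planes X = (\<lambda>(u, v). span {u, v}) ` indep_pairs X"

definition comb :: "nat \<Rightarrow> 'a mat \<Rightarrow> 'b \<Rightarrow> 'b \<Rightarrow> 'b vec" where
  "comb k B u v = vec k (\<lambda>i. B $$ (i, 0) *s u + B $$ (i, 1) *s v)"

text \<open>The elementary tensor of \<open>c\<close> and \<open>g\<close>.\<close>

definition pure :: "nat \<Rightarrow> 'a vec \<Rightarrow> 'b \<Rightarrow> 'b vec" where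
  "pure k c g = vec k (\<lambda>i. c $ i *s g)"

definition tuples :: "nat \<Rightarrow> 'b set \<Rightarrow> 'b vec set" where
  "tuples k X = {comb k B u v | B u v. u \<in> X \<and> v \<in> X \<and> B \<in> carrier_mat k 2}"

definition rank1_tuples :: "nat \<Rightarrow> 'b set \<Rightarrow> 'b vec set" where
  "rank1_tuples k S = (\<lambda>(g, c). pure k c g) ` ((S - {0}) \<times> (carrier_vec k - {0\<^sub>v k}))"

definition rank2_tuples :: "nat \<Rightarrow> 'b set \<Rightarrow> 'b vec set" where
  "rank2_tuples k X = {comb k B u v | B u v. (u, v) \<in> indep_pairs X \<and> B \<in> matrices_of_rank k 2 2}"

text \<open>The invariant that organizes the count: its size separates tuples of rank 2 from pure
  ones, and for a tuple of rank 2 it is the plane that contains the entries.\<close>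

definition entries_span :: "'b vec \<Rightarrow> 'b set" where
  "entries_span f = span (($) f ` {..<dim_vec f})"

section \<open>Independent pairs and the planes they span\<close>

lemma mem_span_pair: "x \<in> span {u, v} \<longleftrightarrow> (\<exists>a b. x = a *s u + b *s v)"
proof -
  have "x \<in> span {u, v} \<longleftrightarrow> (\<exists>a b. x - a *s u - b *s v = 0)"
    by (simp add: span_breakdown_eq)
  then show ?thesis by (simp add: algebra_simps)
qed

lemma indep_pairs_nonzero: "(u, v) \<in> indep_pairs X \<Longrightarrow> u \<noteq> 0 \<and> v \<noteq> 0"
proof (intro conjI notI)
  assume "(u, v) \<in> indep_pairs X"
  then have *: "a *s u + b *s v = 0 \<Longrightarrow> a = 0 \<and> b = 0" for a b by (auto simp: indep_pairs_def)
  show False if "u = 0" using *[of 1 0] that by simp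
  show False if "v = 0" using *[of 0 1] that by simp
qed

lemma indep_pairs_mono: "X \<subseteq> Y \<Longrightarrow> indep_pairs X \<subseteq> indep_pairs Y"
  by (auto simp: indep_pairs_def)

lemma indep_pairs_inj:
  assumes "(u, v) \<in> indep_pairs X" "a *s u + b *s v = c *s u + d *s v"
  shows "a = c \<and> b = d"
proof -
  have "(a - c) *s u + (b - d) *s v = 0"
    using assms(2) by (simp add: scale_left_diff_distrib algebra_simps)
  then have "a - c = 0 \<and> b - d = 0" using assms(1) unfolding indep_pairs_def by blast
  then show ?thesis by simp
qed

lemma finite_card_span_pair:
  assumes "(u, v) \<in> indep_pairs X"
  shows "finite (span {u, v})" "card (span {u, v}) = card (UNIV :: 'a set) ^ 2"
proof -
  have eq: "span {u, v} = (\<lambda>(a, b). a *s u + b *s v) ` UNIV"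
    by (force simp: mem_span_pair)
  have "inj (\<lambda>(a, b). a *s u + b *s v)"
    using indep_pairs_inj[OF assms] by (auto intro!: injI)
  then show "card (span {u, v}) = card (UNIV :: 'a set) ^ 2"
    by (simp add: eq card_image power2_eq_square card_cartesian_product flip: UNIV_Times_UNIV)
  show "finite (span {u, v})" unfolding eq by (simp flip: UNIV_Times_UNIV)
qed

text \<open>One plane lies in the other and both have q^2 elements; counting elements takes the
  place of a dimension argument.\<close>

lemma span_pair_eq:
  assumes "(u, v) \<in> indep_pairs X" "(u', v') \<in> indep_pairs Y"
    and "u' \<in> span {u, v}" "v' \<in> span {u, v}"
  shows "span {u', v'} = span {u, v}"
proof (rule card_subset_eq)
  show "finite (span {u, v})" by (rule finite_card_span_pair(1)[OF assms(1)])
  show "span {u', v'} \<subseteq> span {u, v}" using assms(3,4) by (intro span_minimal) auto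
  show "card (span {u', v'}) = card (span {u, v})"
    using finite_card_span_pair(2)[OF assms(1)] finite_card_span_pair(2)[OF assms(2)] by simp
qed

text \<open>Once a nonzero \<open>u\<close> is chosen, \<open>v\<close> may be any nonzero element
  off the line of \<open>u\<close>. Since \<open>X\<close> is a cone, that line removes exactly q -
  1 nonzero elements.\<close>

lemma card_indep_pairs:
  assumes fin: "finite X" and cone: "\<And>c x. x \<in> X \<Longrightarrow> c *s x \<in> X"
  shows "card (indep_pairs X) = card (X - {0}) * (card (X - {0}) - (card (UNIV :: 'a set) - 1))"
proof -
  have indep_iff: "(\<forall>a b. a *s u + b *s v = 0 \<longrightarrow> a = 0 \<and> b = 0) \<longleftrightarrow> v \<noteq> 0 \<and> (\<forall>c. c \<noteq> 0 \<longrightarrow> v \<noteq> c *s u)"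
    if "u \<noteq> 0" for u v
  proof (intro iffI conjI allI impI notI)
    assume "\<forall>a b. a *s u + b *s v = 0 \<longrightarrow> a = 0 \<and> b = 0" "v = 0"
    then show False by (metis add_0 scale_zero_left scale_zero_right zero_neq_one)
  next
    fix c assume "\<forall>a b. a *s u + b *s v = 0 \<longrightarrow> a = 0 \<and> b = 0" "c \<noteq> 0" "v = c *s u"
    moreover have "(- c) *s u + 1 *s (c *s u) = 0" by simp
    ultimately show False by (metis zero_neq_one)
  next
    fix a b assume v: "v \<noteq> 0 \<and> (\<forall>c. c \<noteq> 0 \<longrightarrow> v \<noteq> c *s u)" and e: "a *s u + b *s v = 0"
    show "b = 0"
    proof (rule ccontr)
      assume "b \<noteq> 0"
      have "b *s v = (- a) *s u" using e by (simp add: eq_neg_iff_add_eq_0 add.commute)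
      then have "inverse b *s b *s v = inverse b *s (- a) *s u" by simp
      then have "v = (- a / b) *s u" using \<open>b \<noteq> 0\<close> by (simp add: field_simps)
      moreover have "a \<noteq> 0" using e v \<open>b \<noteq> 0\<close> by auto
      ultimately show False using v \<open>b \<noteq> 0\<close> by (metis divide_eq_0_iff neg_equal_0_iff_equal)
    qed
    then show "a = 0" using e that by auto
  qed
  define L where "L u = (\<lambda>c. c *s u) ` {c. c \<noteq> 0}" for u
  have "indep_pairs X = Sigma (X - {0}) (\<lambda>u. X - {0} - L u)"
  proof -
    have "(u, v) \<in> indep_pairs X \<longleftrightarrow> u \<in> X - {0} \<and> v \<in> X - {0} - L u" for u v
      using indep_pairs_nonzero[of u v X] indep_iff[of u v]
      by (cases "u = 0") (auto simp: indep_pairs_def L_def)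
    then show ?thesis by auto
  qed
  moreover have "card (X - {0} - L u) = card (X - {0}) - (card (UNIV :: 'a set) - 1)" if u: "u \<in> X - {0}" for u
  proof -
    have "L u \<subseteq> X - {0}" using u cone by (auto simp: L_def)
    moreover have "card (L u) = card (UNIV :: 'a set) - 1"
      unfolding L_def using u by (subst card_image) (auto simp: card_nonzero inj_on_def)
    ultimately show ?thesis by (metis card_Diff_subset fin finite_Diff finite_subset)
  qed
  ultimately show ?thesis using fin by (simp add: card_SigmaI)
qed

text \<open>Double counting of ordered independent pairs: those spanning a plane \<open>W\<close>
  are the independent pairs of \<open>X \<inter> W\<close>, again a cone, so
  \<open>card_indep_pairs\<close> applies both to \<open>X\<close> and to each
  \<open>X \<inter> W\<close>.\<close>

lemma card_planes:
  assumes fin: "finite X" and cone: "\<And>c x. x \<in> X \<Longrightarrow> c *s x \<in> X"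
    and t: "\<And>u v. (u, v) \<in> indep_pairs X \<Longrightarrow> card (X \<inter> span {u, v} - {0}) = t"
  shows "card (X - {0}) * (card (X - {0}) - (card (UNIV :: 'a set) - 1)) =
    t * (t - (card (UNIV :: 'a set) - 1)) * card (planes X)"
proof -
  have fin_pairs: "finite (indep_pairs X)"
    by (rule finite_subset[of _ "X \<times> X"]) (auto simp: indep_pairs_def fin)
  have "card {p \<in> indep_pairs X. (case p of (u, v) \<Rightarrow> span {u, v}) = W}
      = t * (t - (card (UNIV :: 'a set) - 1))" if "W \<in> planes X" for W
  proof -
    obtain u v where uv: "(u, v) \<in> indep_pairs X" and W: "W = span {u, v}"
      using \<open>W \<in> planes X\<close> by (auto simp: planes_def)
    have "{p \<in> indep_pairs X. (case p of (u, v) \<Rightarrow> span {u, v}) = W} = indep_pairs (X \<inter> W)"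
    proof (intro equalityI subsetI)
      fix p assume "p \<in> {p \<in> indep_pairs X. (case p of (u, v) \<Rightarrow> span {u, v}) = W}"
      then show "p \<in> indep_pairs (X \<inter> W)"
        by (auto simp: indep_pairs_def intro: span_base)
    next
      fix p assume p: "p \<in> indep_pairs (X \<inter> W)"
      obtain u' v' where [simp]: "p = (u', v')" by (cases p)
      have "span {u', v'} = W"
        using p unfolding W by (intro span_pair_eq[OF uv]) (auto simp: indep_pairs_def)
      then show "p \<in> {p \<in> indep_pairs X. (case p of (u, v) \<Rightarrow> span {u, v}) = W}"
        using p indep_pairs_mono[of "X \<inter> W" X] by auto
    qed
    moreover have "card (indep_pairs (X \<inter> W)) = t * (t - (card (UNIV :: 'a set) - 1))"
      using card_indep_pairs[of "X \<inter> W"] fin cone t[OF uv] by (auto simp: W span_scale)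
    ultimately show ?thesis by simp
  qed
  then have "card (indep_pairs X) = t * (t - (card (UNIV :: 'a set) - 1)) * card (planes X)"
    using fin_pairs
    by (intro card_eq_mult_card_fibres[where f = "\<lambda>(u, v). span {u, v}"]) (auto simp: planes_def)
  then show ?thesis using card_indep_pairs[OF fin cone] by simp
qed

section \<open>Separating tuples of rank 1 from tuples of rank 2\<close>

lemma entries_span_comb:
  assumes B: "B \<in> matrices_of_rank k 2 2"
  shows "entries_span (comb k B u v) = span {u, v}"
proof -
  let ?f = "comb k B u v"
  obtain i j where ij: "i < k" "j < k"
    and d: "B $$ (i, 0) * B $$ (j, 1) - B $$ (i, 1) * B $$ (j, 0) \<noteq> 0"
    using B rank_eq_two_iff_minor[of B k] by (auto simp: matrices_of_rank_def)
  define a b c e where abce: "a = B $$ (i, 0)" "b = B $$ (i, 1)" "c = B $$ (j, 0)" "e = B $$ (j, 1)"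
  define D where "D = a * e - b * c"
  have D: "D \<noteq> 0" using d by (simp add: D_def abce)
  have fi: "?f $ i = a *s u + b *s v" and fj: "?f $ j = c *s u + e *s v"
    using ij by (simp_all add: comb_def abce)
  \<comment> \<open>Cramer's rule with the minor \<open>D\<close> recovers \<open>u\<close> and
    \<open>v\<close> from two entries of the tuple.\<close>
  have "e *s ?f $ i - b *s ?f $ j = D *s u" "a *s ?f $ j - c *s ?f $ i = D *s v"
    unfolding fi fj D_def by (simp_all add: scale_right_distrib scale_left_diff_distrib algebra_simps)
  then have "u = inverse D *s (e *s ?f $ i - b *s ?f $ j)" "v = inverse D *s (a *s ?f $ j - c *s ?f $ i)"
    using D by simp_all
  moreover have "?f $ i \<in> entries_span ?f" "?f $ j \<in> entries_span ?f"
    using ij by (auto simp: entries_span_def comb_def intro!: span_base)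
  ultimately have "{u, v} \<subseteq> entries_span ?f"
    by (metis (no_types) entries_span_def empty_subsetI insert_subset span_diff span_scale)
  moreover have "($) ?f ` {..<dim_vec ?f} \<subseteq> span {u, v}"
    unfolding comb_def by (simp add: image_subset_iff mem_span_pair) blast
  ultimately show ?thesis
    unfolding entries_span_def by (intro equalityI span_minimal) auto
qed

text \<open>The entries all lie on the line of \<open>g\<close>, which has at most q
  elements.\<close>

lemma card_entries_span_pure: "card (entries_span (pure k c g)) < card (UNIV :: 'a set) ^ 2"
proof -
  have "entries_span (pure k c g) \<subseteq> span {g}"
    unfolding entries_span_def pure_def by (intro span_minimal) (auto intro: span_scale span_base)
  also have "span {g} = (\<lambda>a. a *s g) ` UNIV" by (simp add: span_singleton)
  finally have "card (entries_span (pure k c g)) \<le> card (UNIV :: 'a set)"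
    by (meson card_image_le card_mono finite finite_imageI le_trans)
  also have "\<dots> < card (UNIV :: 'a set) ^ 2"
    using card_field_ge_two[where ?'a = 'a] by (simp add: power2_eq_square)
  finally show ?thesis .
qed

lemma pure_not_rank2: "pure k c g \<notin> rank2_tuples k X"
proof
  assume "pure k c g \<in> rank2_tuples k X"
  then have "card (entries_span (pure k c g)) = card (UNIV :: 'a set) ^ 2"
    by (auto simp: rank2_tuples_def entries_span_comb finite_card_span_pair)
  then show False using card_entries_span_pure[of k c g] by simp
qed

text \<open>With all minors zero, column 1 of \<open>B\<close> is a multiple of column 0, or column
  0 vanishes; either way \<open>B\<close> is a column times a row. The second factor is kept as a
  combination of \<open>u\<close> and \<open>v\<close> so that it stays in the sum of the cone with
  itself.\<close>

lemma comb_eq_pure_if_rank_ne_two: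
  assumes B: "B \<in> carrier_mat k 2" "B \<notin> matrices_of_rank k 2 2"
  shows "\<exists>c\<in>carrier_vec k. \<exists>a b. comb k B u v = pure k c (a *s u + b *s v)"
proof (cases "\<exists>i<k. B $$ (i, 0) \<noteq> 0")
  case True
  then obtain i where i: "i < k" "B $$ (i, 0) \<noteq> 0" by blast
  have "B $$ (j, 1) = B $$ (j, 0) * (B $$ (i, 1) / B $$ (i, 0))" if "j < k" for j
  proof -
    have "B $$ (i, 0) * B $$ (j, 1) - B $$ (i, 1) * B $$ (j, 0) = 0"
      using B rank_eq_two_iff_minor[OF B(1)] i(1) that by (auto simp: matrices_of_rank_def)
    then show ?thesis using i by (simp add: field_simps)
  qed
  then have "comb k B u v = pure k (col B 0) (1 *s u + (B $$ (i, 1) / B $$ (i, 0)) *s v)"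
    using B(1) by (intro eq_vecI) (auto simp: comb_def pure_def scale_right_distrib)
  moreover have "col B 0 \<in> carrier_vec k" using B(1) by auto
  ultimately show ?thesis by blast
next
  case False
  then have "comb k B u v = pure k (col B 1) (0 *s u + 1 *s v)"
    using B(1) by (intro eq_vecI) (auto simp: comb_def pure_def)
  moreover have "col B 1 \<in> carrier_vec k" using B(1) by auto
  ultimately show ?thesis by blast
qed

text \<open>Here the vectors are degenerate, not the matrix: \<open>u\<close> is a multiple of
  \<open>v\<close>, or \<open>v = 0\<close>, so a single vector carries all entries. The conclusion
  has the same form as for a matrix of rank below 2, so both cases are used together.\<close>

lemma comb_eq_pure_if_dependent:
  assumes "B \<in> carrier_mat k 2" "u \<in> X" "v \<in> X" "(u, v) \<notin> indep_pairs X"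
  shows "\<exists>c\<in>carrier_vec k. \<exists>a b. comb k B u v = pure k c (a *s u + b *s v)"
proof -
  obtain a b where e: "a *s u + b *s v = 0" and "a \<noteq> 0 \<or> b \<noteq> 0"
    using assms by (auto simp: indep_pairs_def)
  show ?thesis
  proof (cases "a = 0")
    case False
    have "a *s u = (- b) *s v" using e by (simp add: eq_neg_iff_add_eq_0)
    then have "inverse a *s a *s u = inverse a *s (- b) *s v" by simp
    then have u: "u = (- (b / a)) *s v" using False by (simp add: field_simps)
    have "comb k B u v = pure k (vec k (\<lambda>i. B $$ (i, 0) * (- (b / a)) + B $$ (i, 1))) (0 *s u + 1 *s v)"
      by (intro eq_vecI) (simp_all add: comb_def pure_def, subst u,
        simp add: scale_left_distrib scale_left_diff_distrib)
    then show ?thesis using vec_carrier by blast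
  next
    case True
    then have v: "v = 0" using e \<open>a \<noteq> 0 \<or> b \<noteq> 0\<close> by simp
    have "comb k B u v = pure k (vec k (\<lambda>i. B $$ (i, 0))) (1 *s u + 0 *s v)"
      by (intro eq_vecI) (simp_all add: comb_def pure_def v)
    then show ?thesis using vec_carrier by blast
  qed
qed

text \<open>Scalars are absorbed by the cone, so a degenerate combination is pure with second factor
  in \<open>S\<close>. Disjointness holds because a pure tuple has too small an
  \<open>entries_span\<close>.\<close>

lemma tuples_split:
  assumes cone: "\<And>c x. x \<in> X \<Longrightarrow> c *s x \<in> X" and S: "S = {u + v | u v. u \<in> X \<and> v \<in> X}"
  shows "tuples k X - {0\<^sub>v k} = rank1_tuples k S \<union> rank2_tuples k X"
    and "rank1_tuples k S \<inter> rank2_tuples k X = {}"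
proof -
  have zero: "0\<^sub>v k = pure k (0\<^sub>v k) g" "0\<^sub>v k = pure k c 0" for c g
    by (auto simp: pure_def)
  show "tuples k X - {0\<^sub>v k} = rank1_tuples k S \<union> rank2_tuples k X"
  proof (intro equalityI subsetI)
    fix f assume f: "f \<in> tuples k X - {0\<^sub>v k}"
    then obtain B u v where uv: "u \<in> X" "v \<in> X" and B: "B \<in> carrier_mat k 2"
      and fB: "f = comb k B u v" by (auto simp: tuples_def)
    show "f \<in> rank1_tuples k S \<union> rank2_tuples k X"
    proof (cases "(u, v) \<in> indep_pairs X \<and> B \<in> matrices_of_rank k 2 2")
      case True
      then show ?thesis using fB by (auto simp: rank2_tuples_def)
    next
      case False
      then obtain c a b where c: "c \<in> carrier_vec k" and fc: "f = pure k c (a *s u + b *s v)"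
        using comb_eq_pure_if_rank_ne_two[OF B] comb_eq_pure_if_dependent[OF B uv] fB by blast
      have "c \<noteq> 0\<^sub>v k" "a *s u + b *s v \<noteq> 0" using f fc zero by auto
      moreover have "a *s u + b *s v \<in> S" using uv cone by (auto simp: S)
      ultimately show ?thesis using c fc by (auto simp: rank1_tuples_def)
    qed
  next
    fix f assume "f \<in> rank1_tuples k S \<union> rank2_tuples k X"
    then consider "f \<in> rank1_tuples k S" | "f \<in> rank2_tuples k X" by blast
    then show "f \<in> tuples k X - {0\<^sub>v k}"
    proof cases
      case 1
      then obtain u v c where uv: "u \<in> X" "v \<in> X" "u + v \<noteq> 0"
        and c: "c \<in> carrier_vec k" "c \<noteq> 0\<^sub>v k" and f: "f = pure k c (u + v)"
        by (auto simp: rank1_tuples_def S)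
      \<comment> \<open>Taking \<open>c\<close> for both columns produces
        \<open>c $ i *s (u + v)\<close>.\<close>
      have "f = comb k (mat k 2 (\<lambda>(i, _). c $ i)) u v"
        unfolding f by (intro eq_vecI) (auto simp: pure_def comb_def scale_right_distrib)
      then have "f \<in> tuples k X"
        using uv mat_carrier unfolding tuples_def by blast
      moreover obtain i where "i < k" "c $ i \<noteq> 0"
        using c by (metis carrier_vecD eq_vecI index_zero_vec(1) index_zero_vec(2))
      then have "f $ i \<noteq> 0\<^sub>v k $ i" using uv unfolding f by (simp add: pure_def)
      ultimately show ?thesis by auto
    next
      case 2
      then have "f \<in> tuples k X"
        by (auto simp: rank2_tuples_def tuples_def indep_pairs_def matrices_of_rank_def)
      then show ?thesis using 2 pure_not_rank2 zero by (metis Diff_iff singletonD)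
    qed
  qed
  show "rank1_tuples k S \<inter> rank2_tuples k X = {}"
    using pure_not_rank2 by (auto simp: rank1_tuples_def)
qed

text \<open>The factors of a nonzero elementary tensor are unique up to moving a scalar
  \<open>d\<close> from one to the other, so every fibre of \<open>pure\<close> has q - 1 elements.
  These pairs stay in range because \<open>S\<close> is a cone.\<close>

lemma card_rank1_tuples:
  assumes fin: "finite S" and cone: "\<And>c x. x \<in> S \<Longrightarrow> c *s x \<in> S"
  shows "card (S - {0}) * card (carrier_vec k - {0\<^sub>v k :: 'a vec}) =
    (card (UNIV :: 'a set) - 1) * card (rank1_tuples k S)"
proof -
  let ?A = "(S - {0}) \<times> (carrier_vec k - {0\<^sub>v k :: 'a vec})"
  have fibre: "{x \<in> ?A. (case x of (g, c) \<Rightarrow> pure k c g) = pure k c g}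
      = (\<lambda>d. (inverse d *s g, d \<cdot>\<^sub>v c)) ` {d. d \<noteq> 0}" (is "?L = ?R")
    and inj: "inj_on (\<lambda>d. (inverse d *s g, d \<cdot>\<^sub>v c)) {d. d \<noteq> 0}"
    if gc: "(g, c) \<in> ?A" for g c
  proof -
    have c: "c \<in> carrier_vec k" "c \<noteq> 0\<^sub>v k" and g: "g \<in> S" "g \<noteq> 0" using gc by auto
    \<comment> \<open>A nonzero coordinate of \<open>c\<close> determines the scalar that relates
      two factorizations.\<close>
    obtain i where i: "i < k" "c $ i \<noteq> 0"
      using c by (metis carrier_vecD eq_vecI index_zero_vec(1) index_zero_vec(2))
    show "?L = ?R"
    proof (intro equalityI subsetI)
      fix x assume x: "x \<in> ?L"
      obtain g' c' where [simp]: "x = (g', c')" by (cases x)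
      have c': "c' \<in> carrier_vec k" and eq: "pure k c' g' = pure k c g" using x by auto
      have eqs: "c' $ j *s g' = c $ j *s g" if "j < k" for j
        using arg_cong[OF eq, of "\<lambda>w. w $ j"] that by (simp add: pure_def)
      define d where "d = c' $ i / c $ i"
      have ci': "c' $ i \<noteq> 0" using eqs[OF i(1)] i(2) g by auto
      then have d: "d \<noteq> 0" using i by (simp add: d_def)
      have "inverse (c' $ i) *s c' $ i *s g' = inverse (c' $ i) *s c $ i *s g"
        using eqs[OF i(1)] by simp
      then have g': "g' = inverse d *s g" using ci' by (simp add: d_def field_simps)
      have "c' $ j = d * c $ j" if "j < k" for j
      proof -
        have "(c' $ j * inverse d) *s g = c $ j *s g" using eqs[OF that] g' by simp
        then have "c' $ j * inverse d = c $ j" using g by simp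
        then show ?thesis using d by (auto simp: field_simps)
      qed
      then have "c' = d \<cdot>\<^sub>v c" using c c' by (intro eq_vecI) auto
      then show "x \<in> ?R" using g' d by auto
    next
      fix x assume "x \<in> ?R"
      then obtain d where d: "d \<noteq> 0" and x: "x = (inverse d *s g, d \<cdot>\<^sub>v c)" by auto
      have "pure k (d \<cdot>\<^sub>v c) (inverse d *s g) = pure k c g"
        using d c by (intro eq_vecI) (auto simp: pure_def)
      moreover have "(d \<cdot>\<^sub>v c) $ i \<noteq> 0\<^sub>v k $ i" using d i c by simp
      then have "d \<cdot>\<^sub>v c \<noteq> 0\<^sub>v k" by metis
      ultimately show "x \<in> ?L" using d g c cone x by auto
    qed
    show "inj_on (\<lambda>d. (inverse d *s g, d \<cdot>\<^sub>v c)) {d. d \<noteq> 0}"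
      using g by (auto intro!: inj_onI)
  qed
  have "card {x \<in> ?A. (case x of (g, c) \<Rightarrow> pure k c g) = y} = card (UNIV :: 'a set) - 1"
    if y: "y \<in> rank1_tuples k S" for y
  proof -
    obtain g c where gc: "(g, c) \<in> ?A" "y = pure k c g"
      using y unfolding rank1_tuples_def by auto
    show ?thesis unfolding gc(2) fibre[OF gc(1)] card_image[OF inj[OF gc(1)]] card_nonzero ..
  qed
  then have "card ?A = (card (UNIV :: 'a set) - 1) * card (rank1_tuples k S)"
    using fin finite_carrier_vec[of k, where ?'a = 'a]
    by (intro card_eq_mult_card_fibres[where f = "\<lambda>(g, c). pure k c g"])
      (auto simp: rank1_tuples_def)
  then show ?thesis by (simp add: card_cartesian_product)
qed

lemma finite_tuples: "finite X \<Longrightarrow> finite (tuples k X)"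
proof -
  assume "finite X"
  have "tuples k X = (\<lambda>(B, u, v). comb k B u v) ` (carrier_mat k 2 \<times> X \<times> X)"
    unfolding tuples_def by (auto simp: image_iff) blast+
  then show ?thesis using \<open>finite X\<close> finite_carrier_mat[of k 2, where ?'a = 'a] by simp
qed

text \<open>In a plane with fixed basis \<open>u\<close>, \<open>v\<close>, a tuple is the same as
  its coefficient matrix, and its entries span the plane exactly when that matrix has rank 2. So all
  fibres of \<open>entries_span\<close> have the same size.\<close>

lemma card_rank2_tuples:
  assumes fin: "finite X"
  shows "card (rank2_tuples k X) = card (matrices_of_rank k 2 2 :: 'a mat set) * card (planes X)"
proof (rule card_eq_mult_card_fibres[where f = entries_span])
  show "finite (rank2_tuples k X)"
    by (rule finite_subset[OF _ finite_tuples[OF fin, of k]])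
      (auto simp: rank2_tuples_def tuples_def indep_pairs_def matrices_of_rank_def)
  have "indep_pairs X \<subseteq> X \<times> X" by (auto simp: indep_pairs_def)
  then show "finite (planes X)" using fin unfolding planes_def
    by (meson finite_SigmaI finite_imageI finite_subset)
  show "entries_span ` rank2_tuples k X \<subseteq> planes X"
    by (auto simp: rank2_tuples_def planes_def entries_span_comb)
next
  fix W assume "W \<in> planes X"
  then obtain u v where uv: "(u, v) \<in> indep_pairs X" and W: "W = span {u, v}"
    by (auto simp: planes_def)
  have "{f \<in> rank2_tuples k X. entries_span f = W} = (\<lambda>B. comb k B u v) ` matrices_of_rank k 2 2"
  proof (intro equalityI subsetI)
    fix f assume f: "f \<in> {f \<in> rank2_tuples k X. entries_span f = W}"
    then have dim: "dim_vec f = k" by (auto simp: rank2_tuples_def comb_def)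
    have "\<exists>a b. f $ i = a *s u + b *s v" if "i < k" for i
    proof -
      have "f $ i \<in> entries_span f" using that dim by (auto simp: entries_span_def intro: span_base)
      then show ?thesis using f by (simp add: W mem_span_pair)
    qed
    then obtain a b where ab: "\<And>i. i < k \<Longrightarrow> f $ i = a i *s u + b i *s v" by metis
    define B where "B = mat k 2 (\<lambda>(i, j). if j = 0 then a i else b i)"
    have B: "B \<in> carrier_mat k 2" by (simp add: B_def)
    have fB: "f = comb k B u v" using ab dim by (intro eq_vecI) (auto simp: comb_def B_def)
    \<comment> \<open>With any other rank, \<open>f\<close> would be pure, which a tuple of rank 2
      cannot be.\<close>
    have "B \<in> matrices_of_rank k 2 2"
      using comb_eq_pure_if_rank_ne_two[OF B, of u v] pure_not_rank2 f fB by fastforce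
    then show "f \<in> (\<lambda>B. comb k B u v) ` matrices_of_rank k 2 2" using fB by blast
  next
    fix f assume "f \<in> (\<lambda>B. comb k B u v) ` matrices_of_rank k 2 2"
    then show "f \<in> {f \<in> rank2_tuples k X. entries_span f = W}"
      using uv by (auto simp: rank2_tuples_def W entries_span_comb)
  qed
  moreover have "inj_on (\<lambda>B. comb k B u v) (matrices_of_rank k 2 2)"
  proof (rule inj_onI)
    fix B C assume BC: "B \<in> matrices_of_rank k 2 2" "C \<in> matrices_of_rank k 2 2"
      and eq: "comb k B u v = comb k C u v"
    have "B $$ (i, 0) = C $$ (i, 0) \<and> B $$ (i, 1) = C $$ (i, 1)" if "i < k" for i
      using arg_cong[OF eq, of "\<lambda>w. w $ i"] that
      by (intro indep_pairs_inj[OF uv]) (simp add: comb_def)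
    then show "B = C" using BC
      by (intro eq_matI) (auto simp: matrices_of_rank_def less_2_cases_iff)
  qed
  ultimately show "card {f \<in> rank2_tuples k X. entries_span f = W} =
      card (matrices_of_rank k 2 2 :: 'a mat set)"
    by (simp add: card_image)
qed

section \<open>Passing to classes modulo scalars\<close>

lemma card_projectivization_vec:
  assumes "finite Y" "Y \<subseteq> carrier_vec k" "\<And>c f. f \<in> Y \<Longrightarrow> map_vec (scale c) f \<in> Y"
  shows "card (Y - {0\<^sub>v k}) =
    (card (UNIV :: 'a set) - 1) * card (projectivization (\<lambda>c. map_vec (scale c)) (0\<^sub>v k) Y)"
proof (rule card_diff_zero_eq_projectivization[OF assms(1)])
  have nz: "\<exists>i<k. f $ i \<noteq> 0" if "f \<in> Y - {0\<^sub>v k}" for f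
    using that assms(2) by (metis DiffE carrier_vecD eq_vecI index_zero_vec singletonI subsetD)
  have dim: "dim_vec f = k" if "f \<in> Y - {0\<^sub>v k}" for f
    using that assms(2) by auto
  fix f assume f: "f \<in> Y - {0\<^sub>v k}"
  obtain i where i: "i < k" "f $ i \<noteq> 0" using nz[OF f] by blast
  show "map_vec (scale 1) f = f" by (intro eq_vecI) auto
  show "map_vec (scale c) (map_vec (scale d) f) = map_vec (scale (c * d)) f" for c d
    by (intro eq_vecI) auto
  show "map_vec (scale c) f \<in> Y - {0\<^sub>v k}" if "c \<noteq> 0" for c
  proof -
    have "map_vec (scale c) f $ i \<noteq> 0\<^sub>v k $ i" using that i dim[OF f] by simp
    then have "map_vec (scale c) f \<noteq> 0\<^sub>v k" by metis
    then show ?thesis using assms(3) f by auto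
  qed
  show "c = d" if "map_vec (scale c) f = map_vec (scale d) f" for c d
    using arg_cong[OF that, of "\<lambda>w. w $ i"] i dim[OF f] by simp
qed

text \<open>The split into ranks, counted projectively. The identity keeps the factor q - 1 so that
  it can be stated in the natural numbers; the number of planes is left open because it depends on
  the cone.\<close>

lemma card_proj_tuples:
  assumes fin: "finite X" and cone: "\<And>c x. x \<in> X \<Longrightarrow> c *s x \<in> X"
  defines "P \<equiv> \<lambda>k. projectivization (\<lambda>c. map_vec (scale c)) (0\<^sub>v k) (tuples k X)"
  shows "(card (UNIV :: 'a set) - 1) * card (P k) =
    (card (UNIV :: 'a set) - 1) * (card (P 1) * card (proj_space k :: 'a vec set set)) +
    card (matrices_of_rank k 2 2 :: 'a mat set) * card (planes X)"
proof -
  define S where "S = {u + v | u v. u \<in> X \<and> v \<in> X}"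
  have finS: "finite S"
  proof -
    have "S = (\<lambda>(u, v). u + v) ` (X \<times> X)" by (auto simp: S_def)
    then show ?thesis using fin by simp
  qed
  have coneS: "c *s x \<in> S" if "x \<in> S" for c x
    using that cone unfolding S_def by (clarsimp simp: scale_right_distrib) blast
  let ?q = "card (UNIV :: 'a set) - 1"
  have q: "?q > 0" using card_field_ge_two[where ?'a = 'a] by simp
  have P: "card (tuples k X - {0\<^sub>v k}) = ?q * card (P k)" for k
    unfolding P_def
  proof (rule card_projectivization_vec[OF finite_tuples[OF fin]])
    show "tuples k X \<subseteq> carrier_vec k" by (auto simp: tuples_def comb_def)
    fix c f assume "f \<in> tuples k X"
    then obtain B u v where uv: "u \<in> X" "v \<in> X" and B: "B \<in> carrier_mat k 2"
      and f: "f = comb k B u v" by (auto simp: tuples_def)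
    have "map_vec (scale c) f = comb k B (c *s u) (c *s v)"
      unfolding f by (intro eq_vecI) (auto simp: comb_def scale_right_distrib mult.commute)
    then show "map_vec (scale c) f \<in> tuples k X"
      using uv B cone unfolding tuples_def by blast
  qed
  \<comment> \<open>A 1-tuple is just an element of \<open>S\<close>, which is how
    \<open>P 1\<close> enters the count of tuples of rank 1.\<close>
  have one: "card (tuples 1 X - {0\<^sub>v 1}) = card (S - {0})"
  proof -
    have "tuples 1 X = (\<lambda>g. vec 1 (\<lambda>_. g)) ` S"
    proof (intro equalityI subsetI)
      fix f assume "f \<in> tuples 1 X"
      then obtain B u v where uv: "u \<in> X" "v \<in> X" and f: "f = comb 1 B u v"
        by (auto simp: tuples_def)
      have "f = vec 1 (\<lambda>_. B $$ (0, 0) *s u + B $$ (0, 1) *s v)"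
        unfolding f by (auto simp: comb_def)
      moreover have "B $$ (0, 0) *s u + B $$ (0, 1) *s v \<in> S"
        using uv cone unfolding S_def by blast
      ultimately show "f \<in> (\<lambda>g. vec 1 (\<lambda>_. g)) ` S" by (rule image_eqI)
    next
      fix f assume "f \<in> (\<lambda>g. vec 1 (\<lambda>_. g)) ` S"
      then obtain u v where uv: "u \<in> X" "v \<in> X" and f: "f = vec 1 (\<lambda>_. u + v)"
        by (auto simp: S_def)
      have "f = comb 1 (mat 1 2 (\<lambda>_. 1)) u v" unfolding f by (auto simp: comb_def)
      then show "f \<in> tuples 1 X"
        using uv mat_carrier unfolding tuples_def by blast
    qed
    moreover note inj_vec_1[where ?'b = 'b]
    moreover have "{0\<^sub>v 1} = (\<lambda>g. vec 1 (\<lambda>_. g)) ` {0::'b}" by auto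
    ultimately have "tuples 1 X - {0\<^sub>v 1} = (\<lambda>g. vec 1 (\<lambda>_. g)) ` (S - {0})"
      by (simp only: image_set_diff)
    moreover have "inj_on (\<lambda>g. vec 1 (\<lambda>_. g)) (S - {0})"
      using inj_vec_1 by (rule inj_on_subset) simp
    ultimately show ?thesis by (simp only: card_image)
  qed
  have points: "card (carrier_vec k - {0\<^sub>v k :: 'a vec}) = ?q * card (proj_space k :: 'a vec set set)"
    unfolding proj_space_def
  proof (rule card_diff_zero_eq_projectivization[OF finite_carrier_vec])
    fix v :: "'a vec" assume v: "v \<in> carrier_vec k - {0\<^sub>v k}"
    then obtain i where i: "i < k" "v $ i \<noteq> 0"
      by (metis DiffE carrier_vecD eq_vecI index_zero_vec singletonI)
    show "1 \<cdot>\<^sub>v v = v" by simp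
    show "c \<cdot>\<^sub>v (d \<cdot>\<^sub>v v) = (c * d) \<cdot>\<^sub>v v" for c d by (simp add: smult_smult_assoc)
    show "c \<cdot>\<^sub>v v \<in> carrier_vec k - {0\<^sub>v k}" if "c \<noteq> 0" for c
    proof -
      have "(c \<cdot>\<^sub>v v) $ i \<noteq> 0\<^sub>v k $ i" using that i v by auto
      then have "c \<cdot>\<^sub>v v \<noteq> 0\<^sub>v k" by metis
      then show ?thesis using v by auto
    qed
    show "c = d" if "c \<cdot>\<^sub>v v = d \<cdot>\<^sub>v v" for c d
      using arg_cong[OF that, of "\<lambda>w. w $ i"] i v by auto
  qed
  \<comment> \<open>Both factors of a pure tuple contribute q - 1 choices per projective point; one
    of these cancels against the size of the fibres.\<close>
  have "?q * card (rank1_tuples k S) = ?q * (?q * (card (P 1) * card (proj_space k :: 'a vec set set)))"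
    using card_rank1_tuples[OF finS coneS, of k, unfolded points one[symmetric] P]
    by (simp only: ac_simps)
  then have "card (rank1_tuples k S) = ?q * (card (P 1) * card (proj_space k :: 'a vec set set))"
    using q by simp
  moreover have "card (tuples k X - {0\<^sub>v k}) = card (rank1_tuples k S) + card (rank2_tuples k X)"
  proof -
    note split = tuples_split[OF cone S_def, of k]
    have "finite (rank1_tuples k S \<union> rank2_tuples k X)"
      using finite_tuples[OF fin, of k] by (simp flip: split(1))
    then show ?thesis using split by (simp add: card_Un_disjoint)
  qed
  ultimately show ?thesis using P[of k] card_rank2_tuples[OF fin, of k] by simp
qed

end

section \<open>Powers of linear forms\<close>

lemma single_0_power: "Poly_Mapping.single 0 (c::'a::field) ^ r = (Poly_Mapping.single 0 (c ^ r) :: 'a mpoly)"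
  by (induction r) (simp_all add: mult_single)

lemma mscale_power: "mscale c f ^ r = mscale (c ^ r) (f ^ r)"
  by (simp add: mscale_eq_mult power_mult_distrib single_0_power)

interpretation mpoly: finite_scalars "mscale :: 'a::{field,finite} \<Rightarrow> 'a mpoly \<Rightarrow> 'a mpoly"
proof
  fix a b :: 'a and x y :: "'a mpoly"
  show "mscale a (x + y) = mscale a x + mscale a y"
    by (simp add: mscale_eq_mult distrib_left)
  show "mscale (a + b) x = mscale a x + mscale b x"
    by (simp add: mscale_eq_mult single_add distrib_right)
  show "mscale a (mscale b x) = mscale (a * b) x"
    by (simp add: mscale_eq_mult mult_single flip: mult.assoc)
  show "mscale 1 x = x"
    by (simp add: mscale_eq_mult)
qed

text \<open>The field embeds as the constants, so a multiple of 1 vanishes exactly when its constant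
  coefficient does. This makes Frobenius available for polynomials.\<close>

lemma CHAR_mpoly: "CHAR('a mpoly) = CHAR('a::field)"
proof (rule CHAR_eqI)
  have of_nat: "(of_nat m :: 'a mpoly) = Poly_Mapping.single 0 (of_nat m)" for m by simp
  show "of_nat CHAR('a) = (0 :: 'a mpoly)" by (simp only: of_nat of_nat_CHAR single_zero)
  fix m assume "of_nat m = (0 :: 'a mpoly)"
  then have "Poly_Mapping.lookup (of_nat m :: 'a mpoly) 0 = 0" by simp
  then have "of_nat m = (0 :: 'a)" by (simp add: lookup_of_nat)
  then show "CHAR('a) dvd m" by (simp add: of_nat_eq_0_iff_char_dvd)
qed

lemma prime_CHAR_finite_field: "prime CHAR('a::{field,finite})"
  by (rule prime_CHAR_semidom) (simp add: finite_imp_CHAR_pos)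

section \<open>Linear forms and the cone of their powers\<close>

lemma linear_form_scale: "linear_form n (\<lambda>j. c * a j) = mscale c (linear_form n a)"
  by (simp add: linear_form_def mscale_eq_mult sum_distrib_left mult_single flip: mult.assoc)

lemma linear_form_add: "linear_form n (\<lambda>j. a j + b j) = linear_form n a + linear_form n b"
  by (simp add: linear_form_def mscale_eq_mult single_add distrib_right sum.distrib)

lemma linear_form_cong: "(\<And>j. j < n \<Longrightarrow> a j = b j) \<Longrightarrow> linear_form n a = linear_form n b"
  by (simp add: linear_form_def)

text \<open>The factor \<open>b\<close> makes the set a cone even when some scalars are not
  \<open>r\<close>-th powers.\<close>

definition power_forms :: "nat \<Rightarrow> nat \<Rightarrow> 'a::field mpoly set" where
  "power_forms n r = {mscale b (linear_form n a ^ r) | a b. True}"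

lemma finite_power_forms: "finite (power_forms n r :: 'a::{field,finite} mpoly set)"
proof -
  have "power_forms n r \<subseteq>
    (\<lambda>(a, b). mscale b (linear_form n a ^ r) :: 'a mpoly) ` (PiE {..<n} (\<lambda>_. UNIV) \<times> UNIV)"
  proof
    fix f :: "'a mpoly" assume "f \<in> power_forms n r"
    then obtain a b where "f = mscale b (linear_form n a ^ r)" by (auto simp: power_forms_def)
    \<comment> \<open>Only the first \<open>n\<close> coefficients matter, so finitely many
      coefficient functions suffice.\<close>
    moreover have "linear_form n a = linear_form n (restrict a {..<n})"
      by (rule linear_form_cong) simp
    ultimately show "f \<in> (\<lambda>(a, b). mscale b (linear_form n a ^ r)) ` (PiE {..<n} (\<lambda>_. UNIV) \<times> UNIV)"
      by (intro image_eqI[of _ _ "(restrict a {..<n}, b)"]) auto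
  qed
  then show ?thesis
    by (rule finite_subset) (intro finite_imageI finite_cartesian_product finite_PiE; simp)
qed

lemma power_forms_scale: "f \<in> power_forms n r \<Longrightarrow> mscale c f \<in> power_forms n r"
  for f :: "'a::{field,finite} mpoly"
proof -
  assume "f \<in> power_forms n r"
  then obtain a b where "mscale c f = mscale (c * b) (linear_form n a ^ r)"
    by (auto simp: power_forms_def)
  then show ?thesis unfolding power_forms_def by blast
qed

text \<open>The scalar in each power form can be moved into the corresponding column of the outer
  matrix, so allowing multiples of powers adds no tuples.\<close>

lemma neuromanifold_2_eq_tuples:
  "neuromanifold n 2 k r = mpoly.tuples k (power_forms n r :: 'a::{field,finite} mpoly set)"
proof (intro equalityI subsetI)
  fix f :: "'a mpoly vec" assume "f \<in> neuromanifold n 2 k r"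
  then obtain A B where B: "B \<in> carrier_mat k 2" and f: "f = network_map n 2 k r A B"
    by (auto simp: neuromanifold_def)
  have "f = mpoly.comb k B (mscale 1 (linear_form n (\<lambda>j. A $$ (0, j)) ^ r))
      (mscale 1 (linear_form n (\<lambda>j. A $$ (1, j)) ^ r))"
    unfolding f by (simp add: network_map_def mpoly.comb_def numeral_2_eq_2)
  then show "f \<in> mpoly.tuples k (power_forms n r)"
    using B unfolding mpoly.tuples_def power_forms_def by blast
next
  fix f :: "'a mpoly vec" assume "f \<in> mpoly.tuples k (power_forms n r)"
  then obtain B a b a' b' where B: "B \<in> carrier_mat k 2"
    and f: "f = mpoly.comb k B (mscale b (linear_form n a ^ r)) (mscale b' (linear_form n a' ^ r))"
    unfolding mpoly.tuples_def power_forms_def by blast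
  define A where "A = mat 2 n (\<lambda>(s, j). if s = 0 then a j else a' j)"
  define C where "C = mat k 2 (\<lambda>(i, s). B $$ (i, s) * (if s = 0 then b else b'))"
  have "linear_form n (\<lambda>j. A $$ (0, j)) = linear_form n a"
    "linear_form n (\<lambda>j. A $$ (Suc 0, j)) = linear_form n a'"
    by (rule linear_form_cong; simp add: A_def)+
  then have "f = network_map n 2 k r A C"
    unfolding f by (intro eq_vecI) (auto simp: network_map_def mpoly.comb_def numeral_2_eq_2 C_def)
  moreover have "A \<in> carrier_mat 2 n" "C \<in> carrier_mat k 2" by (simp_all add: A_def C_def)
  ultimately show "f \<in> neuromanifold n 2 k r" unfolding neuromanifold_def by blast
qed

lemma neuromanifold_1_1_eq:
  "neuromanifold n 1 1 r = (\<lambda>g. vec 1 (\<lambda>_. g)) ` (power_forms n r :: 'a::field mpoly set)"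
proof (intro equalityI subsetI)
  fix f :: "'a mpoly vec" assume "f \<in> neuromanifold n 1 1 r"
  then obtain A B where f: "f = network_map n 1 1 r A B"
    by (auto simp: neuromanifold_def)
  have "f = vec 1 (\<lambda>_. mscale (B $$ (0, 0)) (linear_form n (\<lambda>j. A $$ (0, j)) ^ r))"
    unfolding f by (auto simp: network_map_def)
  then show "f \<in> (\<lambda>g. vec 1 (\<lambda>_. g)) ` power_forms n r" unfolding power_forms_def by blast
next
  fix f :: "'a mpoly vec" assume "f \<in> (\<lambda>g. vec 1 (\<lambda>_. g)) ` power_forms n r"
  then obtain a b where f: "f = vec 1 (\<lambda>_. mscale b (linear_form n a ^ r))"
    unfolding power_forms_def by blast
  have "linear_form n (\<lambda>j. mat 1 n (\<lambda>(s, j). a j) $$ (0, j)) = linear_form n a"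
    by (rule linear_form_cong) simp
  then have "f = network_map n 1 1 r (mat 1 n (\<lambda>(s, j). a j)) (mat 1 1 (\<lambda>_. b))"
    unfolding f by (intro eq_vecI) (auto simp: network_map_def)
  then show "f \<in> neuromanifold n 1 1 r"
    unfolding neuromanifold_def by (metis (mono_tags, lifting) mat_carrier mem_Collect_eq)
qed

lemma card_power_forms:
  "card (power_forms n r - {0} :: 'a::{field,finite} mpoly set) =
    (card (UNIV :: 'a set) - 1) * card (proj_neuromanifold n 1 1 r :: 'a mpoly vec set set)"
proof -
  let ?v = "\<lambda>g::'a mpoly. vec 1 (\<lambda>_. g)"
  have "{0\<^sub>v 1} = ?v ` {0}" by auto
  then have "neuromanifold n 1 1 r - {0\<^sub>v 1} = ?v ` (power_forms n r - {0})"
    using inj_vec_1[where ?'b = "'a mpoly"] by (simp only: neuromanifold_1_1_eq image_set_diff)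
  moreover have "inj_on ?v (power_forms n r - {0})" using inj_vec_1 by (rule inj_on_subset) simp
  ultimately have "card (power_forms n r - {0} :: 'a mpoly set) =
      card (neuromanifold n 1 1 r - {0\<^sub>v 1} :: 'a mpoly vec set)"
    by (simp only: card_image)
  also have "\<dots> = (card (UNIV :: 'a set) - 1) * card (proj_neuromanifold n 1 1 r :: 'a mpoly vec set set)"
    unfolding proj_neuromanifold_def neuromanifold_1_1_eq
  proof (rule mpoly.card_projectivization_vec)
    show "finite (?v ` power_forms n r)" by (simp add: finite_power_forms)
    show "?v ` power_forms n r \<subseteq> carrier_vec 1" by auto
    fix c f assume "f \<in> ?v ` power_forms n r"
    then obtain g where g: "g \<in> power_forms n r" "f = ?v g" by blast
    have "map_vec (mscale c) f = ?v (mscale c g)" unfolding g(2) by auto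
    then show "map_vec (mscale c) f \<in> ?v ` power_forms n r"
      using power_forms_scale[OF g(1)] by blast
  qed
  finally show ?thesis .
qed

text \<open>Frobenius is bijective on a finite field, so every scalar is an \<open>r\<close>-th
  power and is absorbed into the linear form; additivity of Frobenius on polynomials then adds the
  forms under the power.\<close>

lemma power_forms_add_if_prime_power:
  fixes f g :: "'a::{field,finite} mpoly"
  assumes r: "r = CHAR('a) ^ i" and "f \<in> power_forms n r" "g \<in> power_forms n r"
  shows "f + g \<in> power_forms n r"
proof -
  have "inj (\<lambda>x::'a. x ^ r)"
  proof (rule injI)
    fix x y :: 'a assume "x ^ r = y ^ r"
    \<comment> \<open>Additivity is applied to \<open>x - y\<close> and \<open>y\<close>, so that
      equal powers force \<open>(x - y) ^ r = 0\<close>.\<close>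
    moreover have "(x - y + y) ^ r = (x - y) ^ r + y ^ r"
      by (rule freshmans_dream'[OF prime_CHAR_finite_field r])
    ultimately have "(x - y) ^ r = 0" by simp
    then show "x = y" by simp
  qed
  then have "surj (\<lambda>x::'a. x ^ r)" by (rule finite_UNIV_inj_surj[OF finite])
  then have root: "\<exists>c::'a. b = c ^ r" for b by (metis surjD)
  have power: "\<exists>a. h = linear_form n a ^ r" if "h \<in> power_forms n r" for h :: "'a mpoly"
  proof -
    obtain a b where h: "h = mscale b (linear_form n a ^ r)"
      using \<open>h \<in> power_forms n r\<close> by (auto simp: power_forms_def)
    obtain c where "b = c ^ r" using root by blast
    then have "h = linear_form n (\<lambda>j. c * a j) ^ r"
      by (simp add: h linear_form_scale mscale_power)
    then show ?thesis by blast
  qed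
  obtain a a' where fg: "f = linear_form n a ^ r" "g = linear_form n a' ^ r"
    using power assms(2,3) by metis
  have "f + g = (linear_form n a + linear_form n a') ^ r"
    unfolding fg
    by (rule freshmans_dream'[symmetric, where n = i])
      (simp_all only: CHAR_mpoly prime_CHAR_finite_field r)
  then have "f + g = mscale 1 (linear_form n (\<lambda>j. a j + a' j) ^ r)"
    by (simp add: linear_form_add)
  then show ?thesis unfolding power_forms_def by blast
qed

section \<open>Substituting univariate polynomials\<close>

definition monomial_eval :: "(nat \<Rightarrow> 'b::comm_monoid_mult) \<Rightarrow> (nat \<Rightarrow>\<^sub>0 nat) \<Rightarrow> 'b" where
  "monomial_eval z e = (\<Prod>j\<in>Poly_Mapping.keys e. z j ^ Poly_Mapping.lookup e j)"

text \<open>The algebra homomorphism to univariate polynomials that sends variable \<open>j\<close>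
  to \<open>z j\<close>.\<close>

definition poly_eval :: "(nat \<Rightarrow> 'a::field poly) \<Rightarrow> 'a mpoly \<Rightarrow> 'a poly" where
  "poly_eval z f = (\<Sum>e\<in>Poly_Mapping.keys f. Polynomial.smult (Poly_Mapping.lookup f e) (monomial_eval z e))"

lemma monomial_eval_add: "monomial_eval z (d + e) = monomial_eval z d * monomial_eval z e"
proof -
  let ?K = "Poly_Mapping.keys d \<union> Poly_Mapping.keys e"
  have *: "monomial_eval z c = (\<Prod>j\<in>?K. z j ^ Poly_Mapping.lookup c j)"
    if "Poly_Mapping.keys c \<subseteq> ?K" for c
    unfolding monomial_eval_def using that
    by (intro prod.mono_neutral_left) (auto simp: in_keys_iff)
  show ?thesis
    using Poly_Mapping.keys_add[of d e]
    by (simp add: * lookup_add power_add prod.distrib)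
qed

lemma poly_eval_superset:
  assumes "finite K" "Poly_Mapping.keys f \<subseteq> K"
  shows "poly_eval z f = (\<Sum>e\<in>K. Polynomial.smult (Poly_Mapping.lookup f e) (monomial_eval z e))"
  unfolding poly_eval_def using assms
  by (intro sum.mono_neutral_left) (auto simp: in_keys_iff)

lemma poly_eval_add: "poly_eval z (f + g) = poly_eval z f + poly_eval z g"
proof -
  let ?K = "Poly_Mapping.keys f \<union> Poly_Mapping.keys g"
  show ?thesis
    using Poly_Mapping.keys_add[of f g]
    by (simp add: poly_eval_superset[of ?K] lookup_add smult_add_left sum.distrib)
qed

lemma poly_eval_0: "poly_eval z 0 = 0"
  by (simp add: poly_eval_def)

lemma poly_eval_sum: "poly_eval z (sum f I) = (\<Sum>i\<in>I. poly_eval z (f i))"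
  by (induction I rule: infinite_finite_induct) (simp_all add: poly_eval_0 poly_eval_add)

lemma poly_eval_single: "poly_eval z (Poly_Mapping.single e c) = Polynomial.smult c (monomial_eval z e)"
  by (simp add: poly_eval_def)

lemma sum_single_eq: "(\<Sum>e\<in>Poly_Mapping.keys f. Poly_Mapping.single e (Poly_Mapping.lookup f e)) = f"
proof (rule poly_mapping_eqI)
  fix e
  have "Poly_Mapping.lookup (\<Sum>d\<in>Poly_Mapping.keys f. Poly_Mapping.single d (Poly_Mapping.lookup f d)) e
      = (\<Sum>d\<in>Poly_Mapping.keys f. if d = e then Poly_Mapping.lookup f d else 0)"
    by (simp add: lookup_sum lookup_single when_def)
  then show "Poly_Mapping.lookup (\<Sum>d\<in>Poly_Mapping.keys f. Poly_Mapping.single d (Poly_Mapping.lookup f d)) e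
      = Poly_Mapping.lookup f e"
    by (simp add: sum.delta in_keys_iff)
qed

lemma poly_eval_mult: "poly_eval z (f * g) = poly_eval z f * poly_eval z g"
proof -
  let ?F = "Poly_Mapping.keys f" and ?G = "Poly_Mapping.keys g"
  let ?f = "Poly_Mapping.lookup f" and ?g = "Poly_Mapping.lookup g"
  have "f * g = (\<Sum>d\<in>?F. \<Sum>e\<in>?G. Poly_Mapping.single (d + e) (?f d * ?g e))"
    by (subst (1 2) sum_single_eq[symmetric]) (simp add: sum_product mult_single)
  then have "poly_eval z (f * g) = (\<Sum>d\<in>?F. \<Sum>e\<in>?G.
      Polynomial.smult (?f d) (monomial_eval z d) * Polynomial.smult (?g e) (monomial_eval z e))"
    by (simp add: poly_eval_sum poly_eval_single monomial_eval_add mult.commute)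
  then show ?thesis by (simp add: poly_eval_def sum_product)
qed

lemma poly_eval_mscale: "poly_eval z (mscale c f) = Polynomial.smult c (poly_eval z f)"
  by (simp add: mscale_eq_mult poly_eval_mult poly_eval_single monomial_eval_def)

lemma poly_eval_power: "poly_eval z (f ^ r) = poly_eval z f ^ r"
proof (induction r)
  case 0
  have "poly_eval z 1 = 1"
    by (subst single_one[symmetric], subst poly_eval_single) (simp add: monomial_eval_def)
  then show ?case by simp
qed (simp add: poly_eval_mult)

lemma poly_eval_linear_form: "poly_eval z (linear_form n a) = (\<Sum>j<n. Polynomial.smult (a j) (z j))"
  by (simp add: linear_form_def poly_eval_sum poly_eval_mscale mvar_def poly_eval_single monomial_eval_def)

text \<open>These are the first two terms of the binomial expansion in \<open>t^Q\<close>, obtained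
  by peeling off one factor at a time; the coefficient at \<open>Q\<close> calls on the one at
  0.\<close>

lemma coeff_two_term_power:
  assumes "Q > 0"
  shows "Polynomial.coeff (([:c:] + Polynomial.monom d Q) ^ s) 0 = c ^ s"
    and "Polynomial.coeff (([:c:] + Polynomial.monom d Q) ^ Suc s) Q =
      of_nat (Suc s) * c ^ s * (d :: 'a::field)"
proof -
  have step: "Polynomial.coeff (([:c:] + Polynomial.monom d Q) * h) j =
      c * Polynomial.coeff h j + (if j < Q then 0 else d * Polynomial.coeff h (j - Q))"
    for h j
    by (simp add: distrib_right coeff_monom_mult)
  show zero: "Polynomial.coeff (([:c:] + Polynomial.monom d Q) ^ s) 0 = c ^ s" for s
    by (induction s) (simp_all add: step assms)
  show "Polynomial.coeff (([:c:] + Polynomial.monom d Q) ^ Suc s) Q = of_nat (Suc s) * c ^ s * d"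
  proof (induction s)
    case 0
    then show ?case using assms by (simp add: coeff_pCons split: nat.split)
  next
    case (Suc s)
    have "Polynomial.coeff (([:c:] + Polynomial.monom d Q) ^ Suc (Suc s)) Q =
        c * (of_nat (Suc s) * c ^ s * d) + d * c ^ Suc s"
      unfolding power_Suc[of _ "Suc s"] step Suc.IH using zero[of "Suc s"] by simp
    then show ?case by (simp add: algebra_simps)
  qed
qed

text \<open>Write \<open>r = Q s\<close> with \<open>Q\<close> a power of the characteristic \<open>p\<close> and \<open>s\<close> prime to \<open>p\<close>. The
  right-hand side is a scalar times the \<open>s\<close>-th power of \<open>l^Q + m^Q t^Q\<close>, whose coefficient at
  \<open>t^Q\<close> is a nonzero multiple of \<open>s\<close>.\<close>

lemma two_term_power_imp_prime_power:
  fixes \<alpha> \<beta> \<gamma> l m :: "'a::{field,finite}"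
  assumes r: "r > 0" and eq: "[:\<alpha>:] + Polynomial.monom \<beta> r = Polynomial.smult \<gamma> ([:l, m:] ^ r)"
    and nz: "\<alpha> \<noteq> 0" "\<beta> \<noteq> 0"
  shows "\<exists>i. r = CHAR('a) ^ i"
proof -
  let ?p = "CHAR('a)"
  have p: "prime ?p" by (rule prime_CHAR_finite_field)
  obtain s where s: "r = ?p ^ multiplicity ?p r * s" "\<not> ?p dvd s"
    using multiplicity_decompose'[of r ?p] r p by (auto simp: prime_nat_iff)
  define Q where "Q = ?p ^ multiplicity ?p r"
  have Q: "Q > 0" using p by (simp add: Q_def prime_gt_0_nat)
  have "[:l, m:] = [:l:] + Polynomial.monom m 1" by (simp add: monom_altdef)
  then have "[:l, m:] ^ Q = [:l:] ^ Q + Polynomial.monom m 1 ^ Q"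
    using freshmans_dream'[of Q "multiplicity ?p r" "[:l:]" "Polynomial.monom m 1"] p by (simp add: Q_def)
  also have "\<dots> = [:l ^ Q:] + Polynomial.monom (m ^ Q) Q"
    by (simp add: monom_power poly_const_pow)
  finally have pow: "[:l, m:] ^ r = ([:l ^ Q:] + Polynomial.monom (m ^ Q) Q) ^ s"
    using s(1) by (metis Q_def power_mult)
  \<comment> \<open>The constant coefficients give \<alpha> = \<gamma> * l^r; the coefficients at
    \<open>r\<close> then exclude \<open>m = 0\<close>, since \<beta> is nonzero.\<close>
  have "l \<noteq> 0 \<and> \<gamma> \<noteq> 0"
    using arg_cong[OF eq, of "\<lambda>h. Polynomial.coeff h 0"] r nz by (auto simp: coeff_0_power power_0_left)
  moreover have "m \<noteq> 0"
  proof
    assume "m = 0"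
    then have "Polynomial.coeff ([:l, m:] ^ r) r = 0"
      using r by (simp add: poly_const_pow coeff_pCons split: nat.split)
    then show False using arg_cong[OF eq, of "\<lambda>h. Polynomial.coeff h r"] r nz
      by (simp add: coeff_pCons split: nat.splits)
  qed
  moreover obtain s' where s': "s = Suc s'" using s(2) by (cases s) auto
  moreover have "of_nat s \<noteq> (0::'a)" using s(2) by (simp add: of_nat_eq_0_iff_char_dvd)
  ultimately have "Polynomial.coeff (Polynomial.smult \<gamma> ([:l, m:] ^ r)) Q \<noteq> 0"
    unfolding pow s' coeff_smult coeff_two_term_power(2)[OF Q] by (simp del: of_nat_Suc)
  \<comment> \<open>The left-hand side of \<open>eq\<close> has terms only in degrees 0 and
    \<open>r\<close>, and \<open>Q\<close> is positive.\<close>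
  then have "Q = r"
    using Q unfolding eq[symmetric] by (auto simp: coeff_pCons split: nat.splits if_splits)
  then show ?thesis unfolding Q_def by metis
qed

text \<open>Otherwise one coefficient vector would be a multiple of the other, and then so would the
  \<open>r\<close>-th powers, against independence.\<close>

lemma linear_forms_minor:
  fixes a a' :: "nat \<Rightarrow> 'a::{field,finite}"
  assumes r: "r > 0"
    and indep: "(mscale b (linear_form n a ^ r), mscale b' (linear_form n a' ^ r)) \<in> mpoly.indep_pairs X"
  obtains i j where "i < n" "j < n" "a j * a' i - a i * a' j \<noteq> 0"
proof -
  have "\<exists>j<n. a j \<noteq> 0"
  proof (rule ccontr)
    assume "\<not> (\<exists>j<n. a j \<noteq> 0)"
    then have "linear_form n a = linear_form n (\<lambda>j. 0 * a j)" by (intro linear_form_cong) auto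
    then have "linear_form n a = 0" by (simp only: linear_form_scale mpoly.scale_zero_left)
    then show False using mpoly.indep_pairs_nonzero[OF indep] r by (simp add: power_0_left)
  qed
  then obtain j where j: "j < n" "a j \<noteq> 0" by blast
  define c where "c = a' j / a j"
  have "\<exists>i<n. a' i \<noteq> c * a i"
  proof (rule ccontr)
    assume "\<not> (\<exists>i<n. a' i \<noteq> c * a i)"
    then have "linear_form n a' = linear_form n (\<lambda>i. c * a i)" by (intro linear_form_cong) auto
    then have a': "linear_form n a' ^ r = mscale (c ^ r) (linear_form n a ^ r)"
      by (simp add: linear_form_scale mscale_power)
    have "b \<noteq> 0" using mpoly.indep_pairs_nonzero[OF indep] by auto
    \<comment> \<open>An explicit relation between the two power forms, nontrivial because its
      second coefficient \<open>b\<close> is nonzero.\<close>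
    have "mscale (- b' * c ^ r) (mscale b (linear_form n a ^ r)) +
        mscale b (mscale b' (linear_form n a' ^ r)) = 0"
      unfolding a' by (simp add: mult_ac)
    then show False using indep \<open>b \<noteq> 0\<close> unfolding mpoly.indep_pairs_def by blast
  qed
  then obtain i where "i < n" "a' i \<noteq> c * a i" by blast
  moreover have "a j * a' i - a i * a' j \<noteq> 0"
    using calculation(2) j by (simp add: c_def field_simps)
  ultimately show ?thesis using that j by blast
qed

text \<open>Substituting a point of \<open>F[t]\<^sup>n\<close> at which two independent linear forms take the values \<open>1\<close>
  and \<open>t\<close> turns a linear relation between three powers into a two-term binomial power.\<close>

lemma power_forms_no_three_collinear:
  fixes u v :: "'a::{field,finite} mpoly"
  assumes r: "r > 0" "\<nexists>i. r = CHAR('a) ^ i"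
    and uv: "(u, v) \<in> mpoly.indep_pairs (power_forms n r)"
    and w: "mscale x u + mscale y v \<in> power_forms n r"
  shows "x = 0 \<or> y = 0"
proof (rule ccontr)
  assume xy: "\<not> (x = 0 \<or> y = 0)"
  obtain a b a' b' where u: "u = mscale b (linear_form n a ^ r)" and v: "v = mscale b' (linear_form n a' ^ r)"
    using uv unfolding mpoly.indep_pairs_def power_forms_def by blast
  obtain a'' b'' where w: "mscale x u + mscale y v = mscale b'' (linear_form n a'' ^ r)"
    using w unfolding power_forms_def by blast
  have b: "b \<noteq> 0" "b' \<noteq> 0" using mpoly.indep_pairs_nonzero[OF uv] by (auto simp: u v)
  obtain i j where ij: "i < n" "j < n" and d: "a j * a' i - a i * a' j \<noteq> 0"
    using linear_forms_minor[OF r(1) uv[unfolded u v]] by blast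
  define D where "D = a j * a' i - a i * a' j"
  have D: "D \<noteq> 0" using d by (simp add: D_def)
  have "i \<noteq> j" using d by (auto simp: mult.commute)
  \<comment> \<open>Coordinates \<open>i\<close> and \<open>j\<close> solve, by Cramer's rule with
    determinant \<open>D\<close>, the system in which the first form takes the value 1 and the
    second takes the value t; all other coordinates are 0.\<close>
  define z where "z m = (if m = j then [:a' i / D, - a i / D:]
    else if m = i then [:- a' j / D, a j / D:] else 0)" for m
  have eval: "poly_eval z (linear_form n c) =
      Polynomial.smult (c j) [:a' i / D, - a i / D:] + Polynomial.smult (c i) [:- a' j / D, a j / D:]" for c
  proof -
    have "poly_eval z (linear_form n c) = (\<Sum>m\<in>{i, j}. Polynomial.smult (c m) (z m))"
      unfolding poly_eval_linear_form using ij
      by (intro sum.mono_neutral_right) (auto simp: z_def)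
    also have "\<dots> = Polynomial.smult (c j) (z j) + Polynomial.smult (c i) (z i)" using \<open>i \<noteq> j\<close> by simp
    finally show ?thesis using \<open>i \<noteq> j\<close> by (simp add: z_def)
  qed
  have La: "poly_eval z (linear_form n a) = 1" "poly_eval z (linear_form n a') = Polynomial.monom 1 1"
    unfolding eval using D
    by (simp_all add: D_def monom_altdef one_pCons diff_divide_distrib[symmetric] mult.commute)
  \<comment> \<open>Since \<open>z\<close> has degree at most 1 in t, the third form becomes some
    \<open>l + m t\<close>.\<close>
  obtain l m where Lc: "poly_eval z (linear_form n a'') = [:l, m:]"
    unfolding eval by simp
  have "Polynomial.smult (x * b) 1 + Polynomial.smult (y * b') (Polynomial.monom 1 1 ^ r) =
      Polynomial.smult b'' ([:l, m:] ^ r)"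
    using arg_cong[OF w, of "poly_eval z"]
    by (simp add: poly_eval_add poly_eval_mscale poly_eval_power u v La Lc)
  then have "[:x * b:] + Polynomial.monom (y * b') r = Polynomial.smult b'' ([:l, m:] ^ r)"
    by (simp add: monom_power smult_monom one_pCons)
  from two_term_power_imp_prime_power[OF r(1) this] show False using r(2) b xy by simp
qed

section \<open>Counting the planes spanned by two powers\<close>

text \<open>Either the plane meets the cone only in the lines of \<open>u\<close> and
  \<open>v\<close>, giving two disjoint punctured lines, or the cone is closed under addition and
  contains the whole plane.\<close>

lemma card_power_forms_plane:
  fixes u v :: "'a::{field,finite} mpoly"
  assumes r: "r > 0" and uv: "(u, v) \<in> mpoly.indep_pairs (power_forms n r)"
  shows "\<nexists>i. r = CHAR('a) ^ i \<Longrightarrow>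
      card (power_forms n r \<inter> mpoly.span {u, v} - {0}) = 2 * (card (UNIV :: 'a set) - 1)"
    and "\<exists>i. r = CHAR('a) ^ i \<Longrightarrow>
      card (power_forms n r \<inter> mpoly.span {u, v} - {0}) = card (UNIV :: 'a set) ^ 2 - 1"
proof -
  have nz: "u \<noteq> 0" "v \<noteq> 0" and mem: "u \<in> power_forms n r" "v \<in> power_forms n r"
    using mpoly.indep_pairs_nonzero[OF uv] uv by (auto simp: mpoly.indep_pairs_def)
  show "card (power_forms n r \<inter> mpoly.span {u, v} - {0}) = 2 * (card (UNIV :: 'a set) - 1)"
    if "\<nexists>i. r = CHAR('a) ^ i"
  proof -
    let ?U = "(\<lambda>c. mscale c u) ` {c. c \<noteq> 0}" and ?V = "(\<lambda>c. mscale c v) ` {c. c \<noteq> 0}"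
    have "power_forms n r \<inter> mpoly.span {u, v} - {0} = ?U \<union> ?V"
    proof (intro equalityI subsetI)
      fix w assume w: "w \<in> power_forms n r \<inter> mpoly.span {u, v} - {0}"
      then obtain x y where xy: "w = mscale x u + mscale y v" by (auto simp: mpoly.mem_span_pair)
      have "x = 0 \<or> y = 0"
        using power_forms_no_three_collinear[OF r that uv] w xy by blast
      then show "w \<in> ?U \<union> ?V" using w xy by auto
    next
      fix w assume "w \<in> ?U \<union> ?V"
      then show "w \<in> power_forms n r \<inter> mpoly.span {u, v} - {0}"
        using nz mem by (auto intro: power_forms_scale mpoly.span_scale mpoly.span_base)
    qed
    moreover have "?U \<inter> ?V = {}"
    proof -
      have "mscale c u \<noteq> mscale d v" if "c \<noteq> 0" for c d
        using mpoly.indep_pairs_inj[OF uv, of c 0 0 d] that by auto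
      then show ?thesis by blast
    qed
    moreover have "card ?U = card (UNIV :: 'a set) - 1" "card ?V = card (UNIV :: 'a set) - 1"
      using nz by (subst card_image; auto simp: card_nonzero inj_on_def)+
    ultimately show ?thesis by (simp add: card_Un_disjoint)
  qed
  show "card (power_forms n r \<inter> mpoly.span {u, v} - {0}) = card (UNIV :: 'a set) ^ 2 - 1"
    if "\<exists>i. r = CHAR('a) ^ i"
  proof -
    obtain i where i: "r = CHAR('a) ^ i" using \<open>\<exists>i. r = CHAR('a) ^ i\<close> by blast
    have "mpoly.span {u, v} \<subseteq> power_forms n r"
      using mem by (auto simp: mpoly.mem_span_pair
          intro!: power_forms_add_if_prime_power[OF i] power_forms_scale)
    then have "power_forms n r \<inter> mpoly.span {u, v} - {0} = mpoly.span {u, v} - {0}" by blast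
    then show ?thesis
      using mpoly.finite_card_span_pair[OF uv] card_Diff_singleton[OF mpoly.span_zero[of "{u, v}"]]
      by simp
  qed
qed

text \<open>With s = q - 1 the cone has s M nonzero elements. In \<open>card_planes\<close> the
  factor t (t - s) is 2 s^2 for t = 2 s, and s^2 q (q + 1) for t = q^2 - 1 = s (q + 1); cancelling
  s^2 leaves M (M - 1) equal to 2 W or to q (q + 1) W.\<close>

lemma card_planes_power_forms:
  fixes n r :: nat
  assumes r: "r > 0"
  defines "q \<equiv> card (UNIV :: 'a::{field,finite} set)"
    and "M \<equiv> card (proj_neuromanifold n 1 1 r :: 'a mpoly vec set set)"
    and "W \<equiv> card (mpoly.planes (power_forms n r :: 'a mpoly set))"
  shows "\<nexists>i. r = CHAR('a) ^ i \<Longrightarrow> real W = real (M choose 2)"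
    and "\<exists>i. r = CHAR('a) ^ i \<Longrightarrow> real W = 2 / ((real q + 1) * real q) * real (M choose 2)"
proof -
  have "q \<ge> 2" unfolding q_def by (rule card_field_ge_two)
  then obtain s where s: "q = s + 1" "s > 0" using that[of "q - 1"] by simp
  have "even (M * (M - 1))" by (cases M) auto
  then have "2 * (M choose 2) = M * (M - 1)" by (simp add: choose_two)
  then have "2 * real (M choose 2) = real M * real (M - 1)" by (metis of_nat_mult of_nat_numeral)
  then have choose: "real (M choose 2) = real M * real (M - 1) / 2" by simp
  have planes: "s * M * (s * M - s) = t * (t - s) * W"
    if "\<And>u v. (u, v) \<in> mpoly.indep_pairs (power_forms n r :: 'a mpoly set) \<Longrightarrow>
      card (power_forms n r \<inter> mpoly.span {u, v} - {0}) = t" for t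
    using mpoly.card_planes[OF finite_power_forms power_forms_scale that]
    unfolding card_power_forms W_def[symmetric] M_def[symmetric] q_def[symmetric] s by simp
  \<comment> \<open>Truncated subtraction does no harm: for \<open>M = 0\<close> both sides are
    0.\<close>
  have M: "s * M * (s * M - s) = s * s * (M * (M - 1))"
    by (simp add: algebra_simps)
  show "real W = real (M choose 2)" if "\<nexists>i. r = CHAR('a) ^ i"
  proof -
    have "s * M * (s * M - s) = (2 * s) * (2 * s - s) * W"
      by (rule planes) (simp add: card_power_forms_plane(1)[OF r _ that] s flip: q_def)
    then have "s * s * (M * (M - 1)) = s * s * (2 * W)" unfolding M by auto
    then have "M * (M - 1) = 2 * W" using s(2) by simp
    then have "real M * real (M - 1) = 2 * real W" by (metis of_nat_mult of_nat_numeral)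
    then show ?thesis by (simp add: choose)
  qed
  show "real W = 2 / ((real q + 1) * real q) * real (M choose 2)" if "\<exists>i. r = CHAR('a) ^ i"
  proof -
    have eq: "s * M * (s * M - s) = (q\<^sup>2 - 1) * (q\<^sup>2 - 1 - s) * W"
      by (rule planes) (simp add: card_power_forms_plane(2)[OF r _ that] flip: q_def)
    have "q\<^sup>2 - 1 = s * (q + 1)" and "s * (q + 1) - s = s * q"
      by (simp_all add: s power2_eq_square algebra_simps)
    from eq[unfolded this M] have "s * s * (M * (M - 1)) = s * s * ((q + 1) * q * W)"
      by (simp only: ac_simps)
    then have "M * (M - 1) = (q + 1) * q * W" using s(2) by simp
    then have "real M * real (M - 1) = (real q + 1) * real q * real W"
      by (metis of_nat_mult of_nat_add of_nat_1)
    moreover have "(real q + 1) * real q \<noteq> 0" using s by simp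
    ultimately show ?thesis by (simp add: choose field_simps)
  qed
qed

theorem corollary4p5p1:
  fixes q p n k r :: nat
  assumes "q = card (UNIV :: 'a::{field, finite} set)" and "p = CHAR('a)"
    and "n > 0" and "k > 0" and "r > 0"
  shows
    "((\<nexists>i::nat. r = p ^ i) \<longrightarrow>
        real (card (proj_neuromanifold n 2 k r :: 'a mpoly vec set set)) =
          real (card (proj_neuromanifold n 2 1 r :: 'a mpoly vec set set))
            * real (card (proj_space k :: 'a vec set set))
          + real (card (proj_neuromanifold n 1 1 r :: 'a mpoly vec set set) choose 2)
            * (real (card (matrices_of_rank k 2 2 :: 'a mat set)) / (real q - 1)))
     \<and> ((\<exists>i::nat. r = p ^ i) \<longrightarrow>
        real (card (proj_neuromanifold n 2 k r :: 'a mpoly vec set set)) =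
          real (card (proj_neuromanifold n 2 1 r :: 'a mpoly vec set set))
            * real (card (proj_space k :: 'a vec set set))
          + 2 / ((real q + 1) * real q)
            * real (card (proj_neuromanifold n 1 1 r :: 'a mpoly vec set set) choose 2)
            * (real (card (matrices_of_rank k 2 2 :: 'a mat set)) / (real q - 1)))"
proof -
  have q: "q \<ge> 2" unfolding assms(1) by (rule card_field_ge_two)
  let ?W = "card (mpoly.planes (power_forms n r :: 'a mpoly set))"
    and ?N = "card (matrices_of_rank k 2 2 :: 'a mat set)"
    and ?P = "card (proj_neuromanifold n 2 k r :: 'a mpoly vec set set)"
    and ?P1 = "card (proj_neuromanifold n 2 1 r :: 'a mpoly vec set set)"
    and ?F = "card (proj_space k :: 'a vec set set)"
  have "(q - 1) * ?P = (q - 1) * (?P1 * ?F) + ?N * ?W"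
    unfolding proj_neuromanifold_def neuromanifold_2_eq_tuples assms(1)
    by (rule mpoly.card_proj_tuples[OF finite_power_forms power_forms_scale])
  then have "real ((q - 1) * ?P) = real ((q - 1) * (?P1 * ?F) + ?N * ?W)" by (rule arg_cong)
  then have "(real q - 1) * real ?P = (real q - 1) * (real ?P1 * real ?F) + real ?N * real ?W"
    using q by (simp add: of_nat_diff)
  \<comment> \<open>Division by q - 1 is possible since q is at least 2; only the number
    \<open>?W\<close> of planes separates the two cases.\<close>
  then have "real ?P = real ?P1 * real ?F + real ?W * (real ?N / (real q - 1))"
    using q by (simp add: field_simps)
  then show ?thesis
    using card_planes_power_forms[OF \<open>r > 0\<close>, where ?'a = 'a, of n]
    unfolding assms(1,2) by metis
qed

end
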